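(* Let $n=2m\ge4$ be even, $0<\alpha,\beta,\gamma,\delta<1$, $\lambda=\alpha-\beta$, $\mu=\gamma-\delta$, and let $p$ be the unique probability vector with $Up=p$, where $U$ is the Markov matrix of the boundary driven rule-54 cellular automaton defined in the context. For $1\le j\le n$ let $\rho_j=\sum_{\underline s\in\{0,1\}^n}s_j\,p_{\underline s}$ be the steady state density. Then $$\rho_j=\frac{\lambda+\mu+4}{\lambda+\mu+8-\lambda\mu}\qquad\text{for all }1<j<n,$$ $$\rho_1=\frac{2(1-\alpha)(\lambda\mu+\lambda+\mu)+(\lambda-2)(\lambda\mu-4)}{2(\lambda+\mu+8-\lambda\mu)},\qquad \rho_n=\frac{2(1-\gamma)(\lambda\mu+\lambda+\mu)+(\mu-2)(\lambda\mu-4)}{2(\lambda+\mu+8-\lambda\mu)} .$$ Moreover, the densities of right-movers and left-movers are independent of position: $$J_{\rm R}:=\sum_{\underline s}s_{2k}s_{2k+1}p_{\underline s}=\frac{\lambda+2}{\lambda+\mu+8-\lambda\mu}\quad(1\le k\le m-1),$$ $$J_{\rm L}:=\sum_{\underline s}s_{2k+1}s_{2k+2}p_{\underline s}=\frac{\mu+2}{\lambda+\mu+8-\lambda\mu}\quad(1\le k\le m-2),$$ so that (for $n\geq 6$) the steady state soliton current is $$J:=J_{\rm R}-J_{\rm L}=\frac{\lambda-\mu}{\lambda+\mu+8-\lambda\mu}.$$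
   Context: Model. Let $\mathbb{Z}_2=\{0,1\}$ and $\chi(w,c,e)= c+w+e+we \pmod 2$ for $w,c,e\in\mathbb{Z}_2$ (the middle argument is the cell being updated). Vectors $p\in\mathbb{R}^{2^n}=(\mathbb{R}^2)^{\otimes n}$ have components $p_{s_1,\dots,s_n}$ indexed by configurations in $\mathbb{Z}_2^n$; matrices act on column vectors (first index = row = final configuration, second index = column = initial configuration). Bulk: $P$ is the $8\times 8$ permutation matrix $P_{(s,s',s''),(t,t',t'')}=\delta_{s,t}\,\delta_{s',\chi(t,t',t'')}\,\delta_{s'',t''}$. Boundaries: $E^{\alpha,\beta}=\begin{pmatrix}1-\alpha&\beta\\ \alpha&1-\beta\end{pmatrix}$, $\tilde P^{\rm L}_{(s',s''),(t',t'')}=\frac12\sum_{s=0}^1 P_{(s,s',s''),(s,t',t'')}$, $\tilde P^{\rm R}_{(s,s'),(t,t')}=\frac12\sum_{s''=0}^1 P_{(s,s',s''),(t,t',s'')}$, $P^{\rm L}=\tilde P^{\rm L}(E^{\alpha,\beta}\otimes \mathbb{1}_2)$, $P^{\rm R}=\tilde P^{\rm R}(\mathbb{1}_2\otimes E^{\gamma,\delta})$. Propagator: with $P_{k,k+1,k+2}=\mathbb{1}_{2^{k-1}}\otimes P\otimes \mathbb{1}_{2^{n-k-2}}$, $P^{\rm L}_{12}=P^{\rm L}\otimes \mathbb{1}_{2^{n-2}}$, $P^{\rm R}_{n-1,n}=\mathbb{1}_{2^{n-2}}\otimes P^{\rm R}$, put $U_{\rm e}=P_{123}P_{345}\cdots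 P_{n-3,n-2,n-1}P^{\rm R}_{n-1,n}$, $U_{\rm o}=P_{n-2,n-1,n}\cdots P_{456}P_{234}P^{\rm L}_{12}$, $U=U_{\rm o}U_{\rm e}$. For $0<\alpha,\beta,\gamma,\delta<1$ the matrix $U$ is irreducible and aperiodic, so the fixed probability vector $p$ exists and is unique. *)

theory Defs
  imports Complex_Main "Jordan_Normal_Form.Matrix"
begin

text \<open>
  A configuration \<open>(s\<^sub>1, \<dots>, s\<^sub>n)\<close> of zeros and ones is encoded by the number
  \<open>i < 2 ^ n\<close> whose binary expansion is \<open>s\<^sub>1 \<dots> s\<^sub>n\<close>, with \<open>s\<^sub>1\<close> the most significant digit.
  This is the ordering of the basis for which the tensor product of matrices is the
  Kronecker product \<open>kron\<close> below. Sites are numbered from 1.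
\<close>

definition site :: "nat \<Rightarrow> nat \<Rightarrow> nat \<Rightarrow> nat" where
  "site n i j = i div 2 ^ (n - j) mod 2"

definition kron :: "real mat \<Rightarrow> real mat \<Rightarrow> real mat" where
  "kron A B = mat (dim_row A * dim_row B) (dim_col A * dim_col B)
     (\<lambda>(i, j). A $$ (i div dim_row B, j div dim_col B) * B $$ (i mod dim_row B, j mod dim_col B))"

definition chi :: "nat \<Rightarrow> nat \<Rightarrow> nat \<Rightarrow> nat" where
  "chi w c e = (c + w + e + w * e) mod 2"

definition P_bulk :: "real mat" where
  "P_bulk = mat 8 8 (\<lambda>(i, j).
     of_bool (site 3 i 1 = site 3 j 1
            \<and> site 3 i 2 = chi (site 3 j 1) (site 3 j 2) (site 3 j 3)
            \<and> site 3 i 3 = site 3 j 3))"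

definition E_mat :: "real \<Rightarrow> real \<Rightarrow> real mat" where
  "E_mat a b = mat_of_rows_list 2 [[1 - a, b], [a, 1 - b]]"

text \<open>
  For two-site configurations \<open>i = (s', s'')\<close> and \<open>i = (s, s')\<close>, the three-site
  configuration \<open>(s, s', s'')\<close> has the code \<open>4 * s + i\<close> and \<open>2 * i + s''\<close>, respectively.
\<close>

definition P_left_tilde :: "real mat" where
  "P_left_tilde = mat 4 4 (\<lambda>(i, j). (1/2) * (\<Sum>s\<in>{0,1}. P_bulk $$ (4 * s + i, 4 * s + j)))"

definition P_right_tilde :: "real mat" where
  "P_right_tilde = mat 4 4 (\<lambda>(i, j). (1/2) * (\<Sum>s\<in>{0,1}. P_bulk $$ (2 * i + s, 2 * j + s)))"

definition P_left :: "real \<Rightarrow> real \<Rightarrow> real mat" where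
  "P_left \<alpha> \<beta> = P_left_tilde * kron (E_mat \<alpha> \<beta>) (1\<^sub>m 2)"

definition P_right :: "real \<Rightarrow> real \<Rightarrow> real mat" where
  "P_right \<gamma> \<delta> = P_right_tilde * kron (1\<^sub>m 2) (E_mat \<gamma> \<delta>)"

definition P_at :: "nat \<Rightarrow> nat \<Rightarrow> real mat" where
  "P_at n k = kron (kron (1\<^sub>m (2 ^ (k - 1))) P_bulk) (1\<^sub>m (2 ^ (n - k - 2)))"

definition P_left_at :: "nat \<Rightarrow> real \<Rightarrow> real \<Rightarrow> real mat" where
  "P_left_at n \<alpha> \<beta> = kron (P_left \<alpha> \<beta>) (1\<^sub>m (2 ^ (n - 2)))"

definition P_right_at :: "nat \<Rightarrow> real \<Rightarrow> real \<Rightarrow> real mat" where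
  "P_right_at n \<gamma> \<delta> = kron (1\<^sub>m (2 ^ (n - 2))) (P_right \<gamma> \<delta>)"

text \<open>
  The propagators are meant for even \<open>n \<ge> 4\<close>: the bulk factors of \<open>U_even\<close> sit at
  \<open>1, 3, \<dots>, n - 3\<close> from left to right, those of \<open>U_odd\<close> at \<open>n - 2, \<dots>, 4, 2\<close>.
\<close>

definition U_even :: "nat \<Rightarrow> real \<Rightarrow> real \<Rightarrow> real mat" where
  "U_even n \<gamma> \<delta> =
     foldr (*) (map (\<lambda>l. P_at n (2 * l - 1)) [1..<n div 2]) (P_right_at n \<gamma> \<delta>)"

definition U_odd :: "nat \<Rightarrow> real \<Rightarrow> real \<Rightarrow> real mat" where
  "U_odd n \<alpha> \<beta> =
     foldr (*) (map (\<lambda>l. P_at n (2 * l)) (rev [1..<n div 2])) (P_left_at n \<alpha> \<beta>)"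

definition U_mat :: "nat \<Rightarrow> real \<Rightarrow> real \<Rightarrow> real \<Rightarrow> real \<Rightarrow> real mat" where
  "U_mat n \<alpha> \<beta> \<gamma> \<delta> = U_odd n \<alpha> \<beta> * U_even n \<gamma> \<delta>"

definition probability_vector :: "nat \<Rightarrow> real vec \<Rightarrow> bool" where
  "probability_vector N p \<longleftrightarrow>
     p \<in> carrier_vec N \<and> (\<forall>i<N. 0 \<le> p $ i) \<and> (\<Sum>i<N. p $ i) = 1"

definition steady_state :: "nat \<Rightarrow> real \<Rightarrow> real \<Rightarrow> real \<Rightarrow> real \<Rightarrow> real vec \<Rightarrow> bool" where
  "steady_state n \<alpha> \<beta> \<gamma> \<delta> p \<longleftrightarrow>
     probability_vector (2 ^ n) p \<and> U_mat n \<alpha> \<beta> \<gamma> \<delta> *\<^sub>v p = p"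

definition density :: "nat \<Rightarrow> real vec \<Rightarrow> nat \<Rightarrow> real" where
  "density n p j = (\<Sum>i<2 ^ n. real (site n i j) * p $ i)"

definition J_right :: "nat \<Rightarrow> real vec \<Rightarrow> nat \<Rightarrow> real" where
  "J_right n p k = (\<Sum>i<2 ^ n. real (site n i (2 * k) * site n i (2 * k + 1)) * p $ i)"

definition J_left :: "nat \<Rightarrow> real vec \<Rightarrow> nat \<Rightarrow> real" where
  "J_left n p k = (\<Sum>i<2 ^ n. real (site n i (2 * k + 1) * site n i (2 * k + 2)) * p $ i)"

end

theory Submission
  imports Defs
begin

text \<open>
  In the steady state the sites \<open>2, \<dots>, n - 1\<close> form a Markov chain with memory two whose
  transition law alternates between even and odd sites. It is built from \<open>u\<close> and \<open>v\<close>, which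
  solve \<open>2 u = 1 + v (\<alpha> - \<beta>)\<close> and \<open>2 v = 1 + u (\<gamma> - \<delta>)\<close>. A half step of the dynamics
  interchanges \<open>u\<close> and \<open>v\<close>: it permutes the configurations of the bulk, so it suffices to
  compare weights, which is a local identity. The marginal of any two neighbouring bulk sites
  has weights proportional to \<open>1 - u, u, u, v\<close> or \<open>1 - v, v, v, u\<close>, which gives the densities.

  For uniqueness, the positive part of the difference of two steady states is again fixed, so
  its support is closed under all transitions. Such a support contains the vacuum, since the
  stochastic boundary sites can be steered to absorb every soliton; hence the positive and the
  negative part of the difference cannot both be nonzero.
\<close>

text \<open>The bulk update is an involution, so a bulk factor acts on a vector by composing its
  weight function with the update; only the two boundary factors contribute a sum. An updated site
  needs both neighbours, which makes the half steps unlike on a prefix of the sites: prefixes end at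
  an odd site, where the even half step closes up while the odd one reads one site beyond. The odd
  case therefore carries the factor of the next site along. The equations for \<open>u\<close> and
  \<open>v\<close> are compatibility conditions at the ends. The boundary laws are chosen to
  reproduce themselves under the stochastic update; resampling site 1 next to a zero then leaves 2u
  = 1 + v(\<alpha> - \<beta>), and the exchange relation at site n leaves 2v = 1 + u(\<gamma> -
  \<delta>). For uniqueness the obstacle is that solitons already in the bulk collide while the
  boundaries are being steered. Growing from the left a region without right-movers avoids following
  individual solitons.\<close>

section \<open>Binary codes, configurations and weight functions\<close>

lemma div_pow2_mod_2_cong:
  fixes x y :: nat
  assumes "x mod 2 ^ N = y mod 2 ^ N" and "t < N"
  shows "x div 2 ^ t mod 2 = y div 2 ^ t mod 2"
proof -
  have "bit x t = bit y t"
    using assms by (metis bit_take_bit_iff take_bit_eq_mod)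
  then show ?thesis
    by (simp add: bit_iff_odd mod2_eq_if)
qed

lemma site_less_2: "site n i j < 2"
  by (simp add: site_def)

lemma site_Suc: "j \<le> n \<Longrightarrow> b < 2 \<Longrightarrow> site (Suc n) (2 * i + b) j = site n i j"
  by (simp add: site_def Suc_diff_le div_mult2_eq)

lemma site_Suc_last: "b < 2 \<Longrightarrow> site (Suc n) (2 * i + b) (Suc n) = b"
  by (simp add: site_def)

text \<open>Horner's scheme, inverse to \<open>site n\<close> between configurations and codes below
  \<open>2 ^ n\<close>. A configuration is a total function of which only the values at 1, ..., n
  count, so single sites can be overwritten by function update.\<close>

primrec enc :: "nat \<Rightarrow> (nat \<Rightarrow> nat) \<Rightarrow> nat" where
  "enc 0 s = 0"
| "enc (Suc n) s = 2 * enc n s + s (Suc n)"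

definition bits :: "nat \<Rightarrow> (nat \<Rightarrow> nat) \<Rightarrow> bool" where
  "bits n s \<longleftrightarrow> (\<forall>j. 1 \<le> j \<and> j \<le> n \<longrightarrow> s j < 2)"

definition eq_upto :: "nat \<Rightarrow> (nat \<Rightarrow> nat) \<Rightarrow> (nat \<Rightarrow> nat) \<Rightarrow> bool" where
  "eq_upto n s t \<longleftrightarrow> (\<forall>j. 1 \<le> j \<and> j \<le> n \<longrightarrow> s j = t j)"

text \<open>Weights take total functions as arguments. Locality is what allows a configuration to be
  replaced by the one decoded from its code, which agrees with it on the sites 1, ..., n
  only.\<close>

definition local_fun :: "nat \<Rightarrow> ((nat \<Rightarrow> nat) \<Rightarrow> real) \<Rightarrow> bool" where
  "local_fun n w \<longleftrightarrow> (\<forall>s t. eq_upto n s t \<longrightarrow> w s = w t)"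

lemma local_funD: "local_fun n w \<Longrightarrow> (\<And>j. 1 \<le> j \<Longrightarrow> j \<le> n \<Longrightarrow> s j = t j) \<Longrightarrow> w s = w t"
  by (auto simp: local_fun_def eq_upto_def)

lemma bits_site: "bits n (site n' i)"
  by (simp add: bits_def site_less_2)

lemma enc_cong: "eq_upto n s t \<Longrightarrow> enc n s = enc n t"
  by (induction n) (auto simp: eq_upto_def)

lemma enc_less: "bits n s \<Longrightarrow> enc n s < 2 ^ n"
proof (induction n)
  case (Suc n)
  then have "enc n s < 2 ^ n" "s (Suc n) < 2" by (auto simp: bits_def)
  then show ?case by simp
qed simp

lemma site_enc: "bits n s \<Longrightarrow> 1 \<le> j \<Longrightarrow> j \<le> n \<Longrightarrow> site n (enc n s) j = s j"
proof (induction n)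
  case (Suc n)
  then have b: "s (Suc n) < 2" "bits n s" by (auto simp: bits_def)
  show ?case
  proof (cases "j = Suc n")
    case True
    then show ?thesis using site_Suc_last[OF b(1)] by simp
  next
    case False
    then show ?thesis using Suc b site_Suc[of j n "s (Suc n)"] by simp
  qed
qed simp

lemma enc_site: "i < 2 ^ n \<Longrightarrow> enc n (site n i) = i"
proof (induction n arbitrary: i)
  case (Suc n)
  have "eq_upto n (site (Suc n) i) (site n (i div 2))"
    using site_Suc[of _ n "i mod 2" "i div 2"] by (simp add: eq_upto_def)
  then have "enc n (site (Suc n) i) = i div 2"
    using Suc by (subst enc_cong[of n _ "site n (i div 2)"]) auto
  moreover have "site (Suc n) i (Suc n) = i mod 2" by (simp add: site_def)
  ultimately show ?case by simp
qed simp

definition vecf :: "nat \<Rightarrow> ((nat \<Rightarrow> nat) \<Rightarrow> real) \<Rightarrow> real vec" where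
  "vecf n w = vec (2 ^ n) (\<lambda>i. w (site n i))"

lemma vecf_carrier [simp]: "vecf n w \<in> carrier_vec (2 ^ n)"
  by (simp add: vecf_def)

lemma vecf_index [simp]: "i < 2 ^ n \<Longrightarrow> vecf n w $ i = w (site n i)"
  by (simp add: vecf_def)

lemma vecf_eqI: "(\<And>s. bits n s \<Longrightarrow> w s = w' s) \<Longrightarrow> vecf n w = vecf n w'"
  by (auto simp: vecf_def bits_site)

lemma vecf_enc: "p \<in> carrier_vec (2 ^ n) \<Longrightarrow> p = vecf n (\<lambda>s. p $ enc n s)"
  by (auto simp: vecf_def enc_site)

lemma vecf_index_enc: "local_fun n w \<Longrightarrow> bits n s \<Longrightarrow> vecf n w $ enc n s = w s"
  by (simp add: enc_less) (rule local_funD, auto simp: site_enc)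

lemma local_fun_enc: "local_fun n (\<lambda>s. p $ enc n s)"
  by (metis enc_cong local_fun_def)

section \<open>Kronecker products acting on a window of sites\<close>

lemma mult_add_less_mult:
  fixes a :: nat
  assumes "a < m" and "b < n"
  shows "a * n + b < m * n"
proof -
  have "a * n + b < (a + 1) * n" using assms by simp
  also have "\<dots> \<le> m * n" using assms by (intro mult_right_mono) auto
  finally show ?thesis .
qed

lemma sum_lessThan_mult:
  fixes f :: "nat \<Rightarrow> 'a::comm_monoid_add"
  shows "(\<Sum>j<a * b. f j) = (\<Sum>j1<a. \<Sum>j2<b. f (j1 * b + j2))"
proof (cases "b = 0")
  case False
  show ?thesis
    unfolding sum.cartesian_product
    by (rule sum.reindex_bij_witness[of _ "\<lambda>(j1, j2). j1 * b + j2" "\<lambda>j. (j div b, j mod b)"])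
      (use False in \<open>auto simp: less_mult_imp_div_less mult_add_less_mult\<close>)
qed simp

lemma kron_carrier: "A \<in> carrier_mat a a' \<Longrightarrow> B \<in> carrier_mat b b' \<Longrightarrow> kron A B \<in> carrier_mat (a * b) (a' * b')"
  by (auto simp: kron_def)

lemma kron_mult_vec_index:
  assumes A: "A \<in> carrier_mat a a'" and B: "B \<in> carrier_mat b b'"
    and p: "p \<in> carrier_vec (a' * b')" and i: "i < a * b"
  shows "(kron A B *\<^sub>v p) $ i =
    (\<Sum>j1<a'. \<Sum>j2<b'. A $$ (i div b, j1) * B $$ (i mod b, j2) * p $ (j1 * b' + j2))"
proof -
  have "(kron A B *\<^sub>v p) $ i = (\<Sum>j<a' * b'. kron A B $$ (i, j) * p $ j)"
    using assms by (auto simp: kron_def scalar_prod_def atLeast0LessThan)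
  also have "\<dots> = (\<Sum>j<a' * b'. A $$ (i div b, j div b') * B $$ (i mod b, j mod b') * p $ j)"
    using assms by (intro sum.cong) (auto simp: kron_def)
  finally show ?thesis by (simp add: sum_lessThan_mult)
qed

lemma kron_one_right: "A \<in> carrier_mat a a' \<Longrightarrow> kron A (1\<^sub>m 1) = A"
  by (rule eq_matI) (auto simp: kron_def)

lemma kron_one_left: "A \<in> carrier_mat a a' \<Longrightarrow> kron (1\<^sub>m 1) A = A"
  by (rule eq_matI) (auto simp: kron_def)

text \<open>An index splits into three mixed-radix digits \<open>i div c div b\<close>,
  \<open>i div c mod b\<close> and \<open>i mod c\<close>. The two identity factors freeze the outer
  digits, so only the middle one is summed over.\<close>

lemma kron_one_sandwich_index:
  assumes M: "M \<in> carrier_mat b b" and p: "p \<in> carrier_vec (a * b * c)" and i: "i < a * b * c"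
  shows "(kron (kron (1\<^sub>m a) M) (1\<^sub>m c) *\<^sub>v p) $ i =
    (\<Sum>j<b. M $$ (i div c mod b, j) * p $ ((i div c div b * b + j) * c + i mod c))"
proof -
  have c: "c > 0" using i by (cases c) auto
  have ic: "i div c < a * b" using i by (simp add: less_mult_imp_div_less)
  have b: "b > 0" using i by (cases b) auto
  have K: "kron (1\<^sub>m a) M \<in> carrier_mat (a * b) (a * b)"
    using M by (intro kron_carrier) auto
  have "(kron (kron (1\<^sub>m a) M) (1\<^sub>m c) *\<^sub>v p) $ i =
     (\<Sum>j1<a * b. \<Sum>j2<c. kron (1\<^sub>m a) M $$ (i div c, j1) * 1\<^sub>m c $$ (i mod c, j2) * p $ (j1 * c + j2))"
    by (rule kron_mult_vec_index[OF K]) (use p i in auto)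
  also have "\<dots> = (\<Sum>j1<a * b. kron (1\<^sub>m a) M $$ (i div c, j1) * p $ (j1 * c + i mod c))"
    using c by (intro sum.cong refl) (simp add: if_distrib if_distribR sum.delta cong: if_cong)
  also have "\<dots> = (\<Sum>j1<a * b. 1\<^sub>m a $$ (i div c div b, j1 div b) * M $$ (i div c mod b, j1 mod b) * p $ (j1 * c + i mod c))"
    using M ic by (intro sum.cong) (auto simp: kron_def)
  also have "\<dots> = (\<Sum>j1<a. \<Sum>j<b. 1\<^sub>m a $$ (i div c div b, j1) * M $$ (i div c mod b, j) * p $ ((j1 * b + j) * c + i mod c))"
    by (simp add: sum_lessThan_mult)
  also have "\<dots> = (\<Sum>j<b. \<Sum>j1<a. 1\<^sub>m a $$ (i div c div b, j1) * M $$ (i div c mod b, j) * p $ ((j1 * b + j) * c + i mod c))"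
    by (rule sum.swap)
  also have "\<dots> = (\<Sum>j<b. M $$ (i div c mod b, j) * p $ ((i div c div b * b + j) * c + i mod c))"
    using ic b by (intro sum.cong refl) (simp add: if_distrib if_distribR sum.delta less_mult_imp_div_less cong: if_cong)
  finally show ?thesis .
qed

definition patch :: "nat \<Rightarrow> nat \<Rightarrow> nat \<Rightarrow> (nat \<Rightarrow> nat) \<Rightarrow> nat \<Rightarrow> nat" where
  "patch k a c s = (\<lambda>l. if k < l \<and> l \<le> k + a then site a c (l - k) else s l)"

text \<open>Sites left of the window depend only on the high quotient of the code, sites right of it
  only on the remainder modulo \<open>2 ^ N\<close>, and those inside only on the replaced digit
  \<open>c\<close>.\<close>

lemma site_patch:
  assumes c: "c < 2 ^ a" and l: "1 \<le> l" "l \<le> k + a + N" and i: "i < 2 ^ (k + a + N)"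
  shows "site (k + a + N) ((i div 2 ^ N div 2 ^ a * 2 ^ a + c) * 2 ^ N + i mod 2 ^ N) l
    = patch k a c (site (k + a + N) i) l"
    (is "site ?n ?J l = _")
proof -
  consider (hi) "l \<le> k" | (mid) "k < l" "l \<le> k + a" | (lo) "k + a < l" by linarith
  then show ?thesis
  proof cases
    case hi
    have e: "?n - l = N + (a + (k - l))" using hi by simp
    have "?J div 2 ^ N div 2 ^ a = i div 2 ^ N div 2 ^ a"
      using c by simp
    then have "?J div 2 ^ (?n - l) = i div 2 ^ (?n - l)"
      unfolding e power_add div_mult2_eq by simp
    then show ?thesis using hi by (simp add: site_def patch_def)
  next
    case mid
    define t where "t = ?n - l - N"
    have e: "?n - l = N + t" "a - (l - k) = t" "t < a" using mid by (auto simp: t_def)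
    have "?J div 2 ^ N div 2 ^ t mod 2 = (i div 2 ^ N div 2 ^ a * 2 ^ a + c) div 2 ^ t mod 2"
      by simp
    also have "\<dots> = c div 2 ^ t mod 2"
      by (rule div_pow2_mod_2_cong[of _ a]) (use e in auto)
    finally have "?J div 2 ^ (N + t) mod 2 = c div 2 ^ t mod 2"
      unfolding power_add div_mult2_eq .
    then show ?thesis using mid by (simp add: site_def patch_def e)
  next
    case lo
    have "?J div 2 ^ (?n - l) mod 2 = i div 2 ^ (?n - l) mod 2"
      by (rule div_pow2_mod_2_cong[of _ N]) (use lo l in auto)
    then show ?thesis using lo by (simp add: site_def patch_def)
  qed
qed

lemma enc_window:
  assumes i: "i < 2 ^ (k + a + N)"
  shows "i div 2 ^ N mod 2 ^ a = enc a (\<lambda>l. site (k + a + N) i (k + l))"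
proof -
  have "enc a (\<lambda>l. site (k + a + N) i (k + l)) = enc a (site a (i div 2 ^ N mod 2 ^ a))"
  proof (rule enc_cong, unfold eq_upto_def, intro allI impI)
    fix l assume l: "1 \<le> l \<and> l \<le> a"
    have "i div 2 ^ N div 2 ^ (a - l) mod 2 = i div 2 ^ N mod 2 ^ a div 2 ^ (a - l) mod 2"
      by (rule div_pow2_mod_2_cong[of _ a]) (use l in auto)
    moreover have "k + a + N - (k + l) = N + (a - l)" using l by simp
    ultimately show "site (k + a + N) i (k + l) = site a (i div 2 ^ N mod 2 ^ a) l"
      by (simp add: site_def power_add div_mult2_eq)
  qed
  then show ?thesis by (simp add: enc_site)
qed

text \<open>The bridge from matrices to weight functions: the middle digit of a code is spelled by
  the sites k + 1, ..., k + a (\<open>enc_window\<close>), and exchanging this digit is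
  \<open>patch\<close> (\<open>site_patch\<close>).\<close>

lemma kron_one_sandwich_vecf:
  assumes M: "M \<in> carrier_mat (2 ^ a) (2 ^ a)" and w: "local_fun n w" and n: "n = k + a + N"
  shows "kron (kron (1\<^sub>m (2 ^ k)) M) (1\<^sub>m (2 ^ N)) *\<^sub>v vecf n w =
    vecf n (\<lambda>s. \<Sum>c<2 ^ a. M $$ (enc a (\<lambda>l. s (k + l)), c) * w (patch k a c s))"
    (is "?K *\<^sub>v _ = _")
proof (rule eq_vecI)
  have dim: "?K \<in> carrier_mat (2 ^ k * 2 ^ a * 2 ^ N) (2 ^ k * 2 ^ a * 2 ^ N)"
    using M by (intro kron_carrier) auto
  then show "dim_vec (?K *\<^sub>v vecf n w) = dim_vec (vecf n (\<lambda>s. \<Sum>c<2 ^ a. M $$ (enc a (\<lambda>l. s (k + l)), c) * w (patch k a c s)))"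
    by (simp add: vecf_def n power_add)
  fix i assume "i < dim_vec (vecf n (\<lambda>s. \<Sum>c<2 ^ a. M $$ (enc a (\<lambda>l. s (k + l)), c) * w (patch k a c s)))"
  then have i: "i < 2 ^ (k + a + N)" by (simp add: vecf_def n)
  have J: "(i div 2 ^ N div 2 ^ a * 2 ^ a + c) * 2 ^ N + i mod 2 ^ N < 2 ^ (k + a + N)" if c: "c < 2 ^ a" for c
  proof -
    have "i div 2 ^ N div 2 ^ a < 2 ^ k"
      using i by (simp add: less_mult_imp_div_less power_add)
    then show ?thesis
      using c by (simp add: power_add mult_add_less_mult)
  qed
  have "(?K *\<^sub>v vecf n w) $ i = (\<Sum>c<2 ^ a. M $$ (i div 2 ^ N mod 2 ^ a, c) *
      vecf n w $ ((i div 2 ^ N div 2 ^ a * 2 ^ a + c) * 2 ^ N + i mod 2 ^ N))"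
    by (rule kron_one_sandwich_index[OF M]) (use i in \<open>auto simp: n power_add vecf_def\<close>)
  also have "\<dots> = (\<Sum>c<2 ^ a. M $$ (enc a (\<lambda>l. site n i (k + l)), c) * w (patch k a c (site n i)))"
  proof (rule sum.cong[OF refl])
    fix c :: nat assume "c \<in> {..<2 ^ a}"
    then have c: "c < 2 ^ a" by simp
    have "w (site n ((i div 2 ^ N div 2 ^ a * 2 ^ a + c) * 2 ^ N + i mod 2 ^ N)) = w (patch k a c (site n i))"
      by (rule local_funD[OF w]) (use site_patch[OF c _ _ i] n in auto)
    then show "M $$ (i div 2 ^ N mod 2 ^ a, c) *
      vecf n w $ ((i div 2 ^ N div 2 ^ a * 2 ^ a + c) * 2 ^ N + i mod 2 ^ N) =
      M $$ (enc a (\<lambda>l. site n i (k + l)), c) * w (patch k a c (site n i))"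
      using J[OF c] enc_window[OF i] by (simp add: n)
  qed
  finally show "(?K *\<^sub>v vecf n w) $ i = vecf n (\<lambda>s. \<Sum>c<2 ^ a. M $$ (enc a (\<lambda>l. s (k + l)), c) * w (patch k a c s)) $ i"
    using i by (simp add: n)
qed

section \<open>Entries of the bulk and boundary matrices\<close>

lemma less_2_cases: "x < (2::nat) \<Longrightarrow> (x = 0 \<Longrightarrow> P) \<Longrightarrow> (x = 1 \<Longrightarrow> P) \<Longrightarrow> P"
  by linarith

lemma less_4_cases:
  "x < (4::nat) \<Longrightarrow> (x = 0 \<Longrightarrow> P) \<Longrightarrow> (x = 1 \<Longrightarrow> P) \<Longrightarrow> (x = 2 \<Longrightarrow> P) \<Longrightarrow> (x = 3 \<Longrightarrow> P) \<Longrightarrow> P"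
  by linarith

lemma less_8_cases:
  "x < (8::nat) \<Longrightarrow> (x = 0 \<Longrightarrow> P) \<Longrightarrow> (x = 1 \<Longrightarrow> P) \<Longrightarrow> (x = 2 \<Longrightarrow> P) \<Longrightarrow> (x = 3 \<Longrightarrow> P) \<Longrightarrow>
    (x = 4 \<Longrightarrow> P) \<Longrightarrow> (x = 5 \<Longrightarrow> P) \<Longrightarrow> (x = 6 \<Longrightarrow> P) \<Longrightarrow> (x = 7 \<Longrightarrow> P) \<Longrightarrow> P"
  by linarith

lemma chi_less_2: "chi w c e < 2"
  by (simp add: chi_def)

text \<open>The increment \<open>w + e + w * e\<close> does not involve the updated cell, so adding
  it twice cancels modulo 2.\<close>

lemma chi_chi:
  assumes "c < 2"
  shows "chi w (chi w c e) e = c"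
proof -
  have *: "((c + k) mod 2 + k) mod 2 = c" for k
    using assms by presburger
  show ?thesis
    using *[of "w + e + w * e"] by (simp add: chi_def add.assoc)
qed

lemma P_bulk_carrier: "P_bulk \<in> carrier_mat 8 8"
  by (simp add: P_bulk_def)

text \<open>\<open>P_bulk\<close> is its own inverse, so the single one in a row stands in the
  column of the updated triple. Hence no inverse map appears when the matrix is applied to a weight
  function.\<close>

lemma P_bulk_index:
  assumes "x < 2" "y < 2" "z < 2" "c < 8"
  shows "P_bulk $$ (4 * x + 2 * y + z, c) = of_bool (c = 4 * x + 2 * chi x y z + z)"
  by (rule less_2_cases[OF assms(1)]; rule less_2_cases[OF assms(2)]; rule less_2_cases[OF assms(3)];
      rule less_8_cases[OF assms(4)]; simp add: P_bulk_def site_def chi_def)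

text \<open>Probability that a boundary site goes from \<open>s\<close> to \<open>t\<close> when its
  inner neighbour is \<open>x\<close>. For \<open>x = 0\<close> averaging over the virtual outer
  site makes the result uniform. For \<open>x = 1\<close> the update is a flip whatever the virtual
  site is, so the rows of \<open>E_mat a b\<close> are interchanged.\<close>

definition boundary_weight :: "real \<Rightarrow> real \<Rightarrow> nat \<Rightarrow> nat \<Rightarrow> nat \<Rightarrow> real" where
  "boundary_weight a b x t s = (if x = 0 then 1 / 2
     else if s = 0 then (if t = 0 then a else 1 - a) else (if t = 0 then 1 - b else b))"

lemma P_left_tilde_index:
  assumes "x < 2" "y < 2" "j < 4"
  shows "P_left_tilde $$ (2 * x + y, j) = (\<Sum>s\<in>{0,1}. of_bool (j = 2 * chi s x y + y)) / 2"
proof -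
  have "P_bulk $$ (2 * x + y, j) = of_bool (j = 2 * chi 0 x y + y)"
    using P_bulk_index[of 0 x y j] assms by simp
  moreover have "P_bulk $$ (4 + (2 * x + y), 4 + j) = of_bool (j = 2 * chi 1 x y + y)"
    using P_bulk_index[of 1 x y "4 + j"] assms by (simp add: add.assoc)
  ultimately show ?thesis using assms
    by (simp add: P_left_tilde_def)
qed

lemma P_right_tilde_index:
  assumes "x < 2" "y < 2" "j < 4"
  shows "P_right_tilde $$ (2 * x + y, j) = (\<Sum>s\<in>{0,1}. of_bool (j = 2 * x + chi x y s)) / 2"
proof -
  have "P_bulk $$ (2 * (2 * x + y) + s, 2 * j + s) = of_bool (j = 2 * x + chi x y s)" if "s < 2" for s
    using P_bulk_index[of x y s "2 * j + s"] assms that by (simp add: algebra_simps)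
  from this[of 0] this[of 1] show ?thesis using assms
    by (simp add: P_right_tilde_def)
qed

lemma E_mat_index:
  "E_mat a b $$ (0, 0) = 1 - a" "E_mat a b $$ (0, Suc 0) = b"
  "E_mat a b $$ (Suc 0, 0) = a" "E_mat a b $$ (Suc 0, Suc 0) = 1 - b"
  by (simp_all add: E_mat_def mat_of_rows_list_def)

lemma E_mat_carrier: "E_mat a b \<in> carrier_mat 2 2"
  by (rule carrier_matI) (simp_all add: E_mat_def mat_of_rows_list_def)

lemma E_mat_dim: "dim_row (E_mat a b) = 2" "dim_col (E_mat a b) = 2"
  by (simp_all add: E_mat_def mat_of_rows_list_def)

lemma sum_lessThan_4: "(\<Sum>k<4. f k) = f 0 + f 1 + f 2 + f (3::nat)"
  by (simp add: eval_nat_numeral)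

lemma sum_lessThan_2: "(\<Sum>k<2. f k) = f 0 + f (1::nat)"
  by (simp add: eval_nat_numeral)

lemma mat_mult_4_index:
  assumes "A \<in> carrier_mat 4 4" "B \<in> carrier_mat 4 4" "i < 4" "j < 4"
  shows "(A * B) $$ (i, j) = (\<Sum>k<4. A $$ (i, k) * B $$ (k, j))"
  using assms by (auto simp: scalar_prod_def atLeast0LessThan)

lemma P_left_carrier: "P_left a b \<in> carrier_mat 4 4"
  using kron_carrier[OF E_mat_carrier one_carrier_mat[of 2]]
  unfolding P_left_def P_left_tilde_def by (intro mult_carrier_mat) auto

lemma P_right_carrier: "P_right a b \<in> carrier_mat 4 4"
  using kron_carrier[OF one_carrier_mat[of 2] E_mat_carrier]
  unfolding P_right_def P_right_tilde_def by (intro mult_carrier_mat) auto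

lemma P_left_index:
  assumes "x < 2" "y < 2" "j < 4"
  shows "P_left a b $$ (2 * x + y, j) = of_bool (j mod 2 = y) * boundary_weight a b y x (j div 2)"
proof -
  have i: "2 * x + y < 4" using assms by linarith
  have "P_left a b $$ (2 * x + y, j) =
      (\<Sum>k<4. P_left_tilde $$ (2 * x + y, k) * kron (E_mat a b) (1\<^sub>m 2) $$ (k, j))"
    unfolding P_left_def
    using kron_carrier[OF E_mat_carrier one_carrier_mat[of 2]]
    by (intro mat_mult_4_index[OF _ _ i assms(3)]) (auto simp: P_left_tilde_def)
  also have "\<dots> = (\<Sum>k<4. (\<Sum>s\<in>{0,1}. of_bool (k = 2 * chi s x y + y)) / 2 * kron (E_mat a b) (1\<^sub>m 2) $$ (k, j))"
    using assms by (intro sum.cong) (simp_all add: P_left_tilde_index)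
  also have "\<dots> = of_bool (j mod 2 = y) * boundary_weight a b y x (j div 2)"
    by (rule less_2_cases[OF assms(1)]; rule less_2_cases[OF assms(2)]; rule less_4_cases[OF assms(3)];
        simp add: sum_lessThan_4 kron_def E_mat_dim E_mat_index boundary_weight_def chi_def field_simps)
  finally show ?thesis .
qed

lemma P_right_index:
  assumes "x < 2" "y < 2" "j < 4"
  shows "P_right a b $$ (2 * x + y, j) = of_bool (j div 2 = x) * boundary_weight a b x y (j mod 2)"
proof -
  have i: "2 * x + y < 4" using assms by linarith
  have "P_right a b $$ (2 * x + y, j) =
      (\<Sum>k<4. P_right_tilde $$ (2 * x + y, k) * kron (1\<^sub>m 2) (E_mat a b) $$ (k, j))"
    unfolding P_right_def
    using kron_carrier[OF one_carrier_mat[of 2] E_mat_carrier]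
    by (intro mat_mult_4_index[OF _ _ i assms(3)]) (auto simp: P_right_tilde_def)
  also have "\<dots> = (\<Sum>k<4. (\<Sum>s\<in>{0,1}. of_bool (k = 2 * x + chi x y s)) / 2 * kron (1\<^sub>m 2) (E_mat a b) $$ (k, j))"
    using assms by (intro sum.cong) (simp_all add: P_right_tilde_index)
  also have "\<dots> = of_bool (j div 2 = x) * boundary_weight a b x y (j mod 2)"
    by (rule less_2_cases[OF assms(1)]; rule less_2_cases[OF assms(2)]; rule less_4_cases[OF assms(3)];
        simp add: sum_lessThan_4 kron_def E_mat_dim E_mat_index boundary_weight_def chi_def field_simps)
  finally show ?thesis .
qed

section \<open>The two half steps as operations on weight functions\<close>

definition upd :: "nat \<Rightarrow> (nat \<Rightarrow> nat) \<Rightarrow> nat \<Rightarrow> nat" where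
  "upd k s = s(k := chi (s (k - 1)) (s k) (s (k + 1)))"

lemma P_at_carrier: "1 \<le> k \<Longrightarrow> k + 2 \<le> n \<Longrightarrow> P_at n k \<in> carrier_mat (2 ^ n) (2 ^ n)"
proof -
  assume k: "1 \<le> k" "k + 2 \<le> n"
  have "P_at n k \<in> carrier_mat (2 ^ (k - 1) * 8 * 2 ^ (n - k - 2)) (2 ^ (k - 1) * 8 * 2 ^ (n - k - 2))"
    unfolding P_at_def by (intro kron_carrier P_bulk_carrier) auto
  moreover have "(2::nat) ^ (k - 1) * 8 * 2 ^ (n - k - 2) = 2 ^ (k - 1 + 3 + (n - k - 2))"
    unfolding power_add by simp
  moreover have "k - 1 + 3 + (n - k - 2) = n" using k by simp
  ultimately show ?thesis by metis
qed

lemma P_left_at_carrier: "2 \<le> n \<Longrightarrow> P_left_at n a b \<in> carrier_mat (2 ^ n) (2 ^ n)"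
proof -
  assume n: "2 \<le> n"
  have "P_left_at n a b \<in> carrier_mat (4 * 2 ^ (n - 2)) (4 * 2 ^ (n - 2))"
    unfolding P_left_at_def by (intro kron_carrier P_left_carrier) auto
  moreover have "(4::nat) * 2 ^ (n - 2) = 2 ^ (2 + (n - 2))"
    unfolding power_add by simp
  moreover have "2 + (n - 2) = n" using n by simp
  ultimately show ?thesis by metis
qed

lemma P_right_at_carrier: "2 \<le> n \<Longrightarrow> P_right_at n a b \<in> carrier_mat (2 ^ n) (2 ^ n)"
proof -
  assume n: "2 \<le> n"
  have "P_right_at n a b \<in> carrier_mat (2 ^ (n - 2) * 4) (2 ^ (n - 2) * 4)"
    unfolding P_right_at_def by (intro kron_carrier P_right_carrier) auto
  moreover have "(2::nat) ^ (n - 2) * 4 = 2 ^ (2 + (n - 2))"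
    unfolding power_add by simp
  moreover have "2 + (n - 2) = n" using n by simp
  ultimately show ?thesis by metis
qed

lemma site_3:
  assumes "x < 2" "y < 2" "z < 2"
  shows "site 3 (4 * x + 2 * y + z) 1 = x" "site 3 (4 * x + 2 * y + z) 2 = y"
    "site 3 (4 * x + 2 * y + z) 3 = z"
  by (rule less_2_cases[OF assms(1)]; rule less_2_cases[OF assms(2)]; rule less_2_cases[OF assms(3)];
      simp add: site_def)+

text \<open>The window of \<open>P_at n k\<close> consists of the sites k, k + 1, k + 2, and its
  middle site is the updated one; hence the shift by one.\<close>

lemma P_at_vecf:
  assumes k: "1 \<le> k" "k + 2 \<le> n" and w: "local_fun n w"
  shows "P_at n k *\<^sub>v vecf n w = vecf n (\<lambda>s. w (upd (k + 1) s))"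
proof -
  have "P_at n k *\<^sub>v vecf n w = vecf n (\<lambda>s. \<Sum>c<2 ^ 3. P_bulk $$ (enc 3 (\<lambda>l. s (k - 1 + l)), c) * w (patch (k - 1) 3 c s))"
    unfolding P_at_def
    by (rule kron_one_sandwich_vecf[OF _ w]) (use k P_bulk_carrier in auto)
  also have "\<dots> = vecf n (\<lambda>s. w (upd (k + 1) s))"
  proof (rule vecf_eqI)
    fix s assume s: "bits n s"
    define x y z where "x = s k" and "y = s (k + 1)" and "z = s (k + 2)"
    have b: "x < 2" "y < 2" "z < 2" using s k by (auto simp: bits_def x_def y_def z_def)
    define c0 where "c0 = 4 * x + 2 * chi x y z + z"
    have c0: "c0 < 8" using b chi_less_2[of x y z] by (simp add: c0_def)
    have e: "enc 3 (\<lambda>l. s (k - 1 + l)) = 4 * x + 2 * y + z"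
      using k by (simp add: eval_nat_numeral x_def y_def z_def)
    have "(\<Sum>c<2 ^ 3. P_bulk $$ (enc 3 (\<lambda>l. s (k - 1 + l)), c) * w (patch (k - 1) 3 c s)) =
        (\<Sum>c<8. if c = c0 then w (patch (k - 1) 3 c s) else 0)"
      unfolding e by (intro sum.cong) (auto simp: P_bulk_index[OF b] c0_def)
    also have "\<dots> = w (patch (k - 1) 3 c0 s)"
      using c0 by simp
    also have "\<dots> = w (upd (k + 1) s)"
    proof (rule local_funD[OF w])
      fix l assume l: "1 \<le> l" "l \<le> n"
      have c0_sites: "site 3 c0 1 = x" "site 3 c0 2 = chi x y z" "site 3 c0 3 = z"
        using site_3[OF b(1) chi_less_2[of x y z] b(3)] by (simp_all add: c0_def)
      have k': "k - (k - 1) = 1" "k + 1 - (k - 1) = 2" "k + 2 - (k - 1) = 3" "k - 1 < k" "l < k \<Longrightarrow> \<not> k - 1 < l"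
        using k by auto
      consider "l = k" | "l = k + 1" | "l = k + 2" | "l < k" | "l > k + 2" by linarith
      then show "patch (k - 1) 3 c0 s l = upd (k + 1) s l"
        by cases (use k k' c0_sites in \<open>simp_all add: patch_def upd_def x_def y_def z_def\<close>)
    qed
    finally show "(\<Sum>c<2 ^ 3. P_bulk $$ (enc 3 (\<lambda>l. s (k - 1 + l)), c) * w (patch (k - 1) 3 c s)) = w (upd (k + 1) s)" .
  qed
  finally show ?thesis .
qed

lemma site_2:
  assumes "x < 2" "y < 2"
  shows "site 2 (2 * x + y) 1 = x" "site 2 (2 * x + y) 2 = y"
  using assms by (simp_all add: site_def)

lemma P_left_at_vecf:
  assumes n: "2 \<le> n" and w: "local_fun n w"
  shows "P_left_at n a b *\<^sub>v vecf n w = vecf n (\<lambda>s. \<Sum>t<2. boundary_weight a b (s 2) (s 1) t * w (s(1 := t)))"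
proof -
  have "P_left_at n a b = kron (kron (1\<^sub>m (2 ^ 0)) (P_left a b)) (1\<^sub>m (2 ^ (n - 2)))"
    using kron_one_left[OF P_left_carrier] by (simp add: P_left_at_def)
  then have "P_left_at n a b *\<^sub>v vecf n w = vecf n (\<lambda>s. \<Sum>c<2 ^ 2. P_left a b $$ (enc 2 (\<lambda>l. s (0 + l)), c) * w (patch 0 2 c s))"
    using kron_one_sandwich_vecf[OF _ w, of "P_left a b" 2 0 "n - 2"] P_left_carrier n by simp
  also have "\<dots> = vecf n (\<lambda>s. \<Sum>t<2. boundary_weight a b (s 2) (s 1) t * w (s(1 := t)))"
  proof (rule vecf_eqI)
    fix s assume s: "bits n s"
    have b: "s 1 < 2" "s 2 < 2" using s n by (auto simp: bits_def)
    have e: "enc 2 (\<lambda>l. s (0 + l)) = 2 * s 1 + s 2"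
      by (simp add: eval_nat_numeral)
    have p: "w (patch 0 2 (2 * t + s 2) s) = w (s(1 := t))" if t: "t < 2" for t
    proof (rule local_funD[OF w])
      fix l assume l: "1 \<le> l" "l \<le> n"
      have sites: "site 2 (2 * t + s 2) 1 = t" "site 2 (2 * t + s 2) 2 = s 2"
        using site_2[OF t b(2)] by auto
      consider "l = 1" | "l = 2" | "l > 2" using l by linarith
      then show "patch 0 2 (2 * t + s 2) s l = (s(1 := t)) l"
        by cases (use sites in \<open>simp_all add: patch_def\<close>)
    qed
    have "(\<Sum>c<2 ^ 2. P_left a b $$ (2 * s 1 + s 2, c) * w (patch 0 2 c s)) =
       (\<Sum>c<4. of_bool (c mod 2 = s 2) * boundary_weight a b (s 2) (s 1) (c div 2) * w (patch 0 2 c s))"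
      using b by (intro sum.cong) (simp_all add: P_left_index)
    also have "\<dots> = (\<Sum>t<2. boundary_weight a b (s 2) (s 1) t * w (patch 0 2 (2 * t + s 2) s))"
      using b(2) by (rule less_2_cases) (simp_all add: sum_lessThan_4 sum_lessThan_2)
    finally show "(\<Sum>c<2 ^ 2. P_left a b $$ (enc 2 (\<lambda>l. s (0 + l)), c) * w (patch 0 2 c s)) =
       (\<Sum>t<2. boundary_weight a b (s 2) (s 1) t * w (s(1 := t)))"
      unfolding e using p by simp
  qed
  finally show ?thesis .
qed

lemma P_right_at_vecf:
  assumes n: "2 \<le> n" and w: "local_fun n w"
  shows "P_right_at n a b *\<^sub>v vecf n w = vecf n (\<lambda>s. \<Sum>t<2. boundary_weight a b (s (n - 1)) (s n) t * w (s(n := t)))"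
proof -
  have "kron (1\<^sub>m (2 ^ (n - 2))) (P_right a b) \<in> carrier_mat (2 ^ (n - 2) * 4) (2 ^ (n - 2) * 4)"
    by (intro kron_carrier P_right_carrier) auto
  then have "P_right_at n a b = kron (kron (1\<^sub>m (2 ^ (n - 2))) (P_right a b)) (1\<^sub>m (2 ^ 0))"
    using kron_one_right by (simp add: P_right_at_def)
  then have "P_right_at n a b *\<^sub>v vecf n w = vecf n (\<lambda>s. \<Sum>c<2 ^ 2. P_right a b $$ (enc 2 (\<lambda>l. s (n - 2 + l)), c) * w (patch (n - 2) 2 c s))"
    using kron_one_sandwich_vecf[OF _ w, of "P_right a b" 2 "n - 2" 0] P_right_carrier n by simp
  also have "\<dots> = vecf n (\<lambda>s. \<Sum>t<2. boundary_weight a b (s (n - 1)) (s n) t * w (s(n := t)))"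
  proof (rule vecf_eqI)
    fix s assume s: "bits n s"
    have b: "s (n - 1) < 2" "s n < 2" using s n by (auto simp: bits_def)
    have "n - 2 + 1 = n - 1" "n - 2 + 2 = n" using n by auto
    then have e: "enc 2 (\<lambda>l. s (n - 2 + l)) = 2 * s (n - 1) + s n"
      by (simp add: eval_nat_numeral)
    have p: "w (patch (n - 2) 2 (2 * s (n - 1) + t) s) = w (s(n := t))" if t: "t < 2" for t
    proof (rule local_funD[OF w])
      fix l assume l: "1 \<le> l" "l \<le> n"
      have sites: "site 2 (2 * s (n - 1) + t) 1 = s (n - 1)" "site 2 (2 * s (n - 1) + t) 2 = t"
        using site_2[OF b(1) t] by auto
      obtain q where q: "n = q + 2" using n by (metis add.commute le_Suc_ex)
      consider "l = n - 1" | "l = n" | "l < n - 1" using l by linarith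
      then show "patch (n - 2) 2 (2 * s (n - 1) + t) s l = (s(n := t)) l"
        by cases (use sites in \<open>simp_all add: patch_def q\<close>)
    qed
    have "(\<Sum>c<2 ^ 2. P_right a b $$ (2 * s (n - 1) + s n, c) * w (patch (n - 2) 2 c s)) =
       (\<Sum>c<4. of_bool (c div 2 = s (n - 1)) * boundary_weight a b (s (n - 1)) (s n) (c mod 2) * w (patch (n - 2) 2 c s))"
      using b by (intro sum.cong) (simp_all add: P_right_index)
    also have "\<dots> = (\<Sum>t<2. boundary_weight a b (s (n - 1)) (s n) t * w (patch (n - 2) 2 (2 * s (n - 1) + t) s))"
      using b(1) by (rule less_2_cases) (simp_all add: sum_lessThan_4 sum_lessThan_2 flip: numeral_2_eq_2)
    finally show "(\<Sum>c<2 ^ 2. P_right a b $$ (enc 2 (\<lambda>l. s (n - 2 + l)), c) * w (patch (n - 2) 2 c s)) =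
       (\<Sum>t<2. boundary_weight a b (s (n - 1)) (s n) t * w (s(n := t)))"
      unfolding e using p by simp
  qed
  finally show ?thesis .
qed

text \<open>No two of the listed sites are adjacent, so no update changes a value that another one
  reads, and all of them see the original neighbours. Site 0 is excluded because
  \<open>j - 1\<close> truncates to \<open>j\<close> there.\<close>

lemma fold_upd:
  assumes "distinct xs" and "\<And>x y. x \<in> set xs \<Longrightarrow> y \<in> set xs \<Longrightarrow> y \<noteq> x + 1" and "0 \<notin> set xs"
  shows "fold upd xs s = (\<lambda>j. if j \<in> set xs then chi (s (j - 1)) (s j) (s (j + 1)) else s j)"
  using assms
proof (induction xs arbitrary: s)
  case (Cons x xs)
  have "fold upd xs (upd x s) = (\<lambda>j. if j \<in> set xs then chi (upd x s (j - 1)) (upd x s j) (upd x s (j + 1)) else upd x s j)"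
    by (rule Cons.IH) (use Cons.prems in auto)
  moreover have "j - 1 \<noteq> x" "j \<noteq> x" "j + 1 \<noteq> x" if "j \<in> set xs" for j
  proof -
    have "j \<noteq> 0" using that Cons.prems(3) by (metis list.set_intros(2))
    then show "j - 1 \<noteq> x" using Cons.prems(2)[of x j] that by auto
    show "j \<noteq> x" using Cons.prems(1) that by auto
    show "j + 1 \<noteq> x" using Cons.prems(2)[of j x] that by auto
  qed
  moreover have "upd x s j = (if j = x then chi (s (x - 1)) (s x) (s (x + 1)) else s j)" for j
    by (simp add: upd_def)
  ultimately show ?case
    by (auto simp: fun_eq_iff)
qed simp

lemma local_fun_upd:
  assumes "local_fun n w" "2 \<le> k" "k < n"
  shows "local_fun n (\<lambda>s. w (upd k s))"
  unfolding local_fun_def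
proof (intro allI impI)
  fix s t assume "eq_upto n s t"
  then have eq: "s j = t j" if "1 \<le> j" "j \<le> n" for j
    using that by (simp add: eq_upto_def)
  then show "w (upd k s) = w (upd k t)"
    using eq[of "k - 1"] eq[of k] eq[of "k + 1"] assms(2,3)
    by (intro local_funD[OF assms(1)]) (simp add: upd_def)
qed

lemma local_fun_fold_upd:
  assumes "local_fun n w" "\<forall>x\<in>set xs. 2 \<le> x \<and> x < n"
  shows "local_fun n (\<lambda>s. w (fold upd xs s))"
  using assms by (induction xs) (auto intro: local_fun_upd[where w = "\<lambda>s. w (fold upd xs s)" for xs])

text \<open>Composition on the argument side reverses the order: the outermost factor, although
  applied last to the vector, updates the configuration first. Hence \<open>foldr\<close> on
  matrices becomes \<open>fold\<close> on configurations.\<close>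

lemma foldr_P_at_vecf:
  assumes M: "M \<in> carrier_mat (2 ^ n) (2 ^ n)" "M *\<^sub>v vecf n w = vecf n w'"
    and w': "local_fun n w'" and xs: "\<forall>x\<in>set xs. 1 \<le> f x \<and> f x + 2 \<le> n"
  shows "foldr (*) (map (\<lambda>x. P_at n (f x)) xs) M \<in> carrier_mat (2 ^ n) (2 ^ n) \<and>
    foldr (*) (map (\<lambda>x. P_at n (f x)) xs) M *\<^sub>v vecf n w = vecf n (\<lambda>s. w' (fold upd (map (\<lambda>x. f x + 1) xs) s))"
  using xs
proof (induction xs)
  case Nil
  then show ?case using M by simp
next
  case (Cons x xs)
  let ?F = "foldr (*) (map (\<lambda>x. P_at n (f x)) xs) M"
  have x: "1 \<le> f x" "f x + 2 \<le> n" using Cons by auto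
  have F: "?F \<in> carrier_mat (2 ^ n) (2 ^ n)"
    "?F *\<^sub>v vecf n w = vecf n (\<lambda>s. w' (fold upd (map (\<lambda>x. f x + 1) xs) s))"
    using Cons by auto
  have "(P_at n (f x) * ?F) *\<^sub>v vecf n w = P_at n (f x) *\<^sub>v (?F *\<^sub>v vecf n w)"
    by (rule assoc_mult_mat_vec[OF P_at_carrier[OF x] F(1)]) simp
  also have "\<dots> = vecf n (\<lambda>s. w' (fold upd (map (\<lambda>x. f x + 1) xs) (upd (f x + 1) s)))"
    unfolding F(2)
  proof (rule P_at_vecf[OF x])
    show "local_fun n (\<lambda>s. w' (fold upd (map (\<lambda>x. f x + 1) xs) s))"
      by (rule local_fun_fold_upd[OF w']) (use Cons in auto)
  qed
  finally show ?case using P_at_carrier[OF x] F(1) by (simp add: o_def)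
qed

text \<open>For even n the strict bounds leave out the boundary site of parity \<open>d\<close>,
  which is n for \<open>d = 0\<close> and 1 for \<open>d = 1\<close>; it is resampled
  separately.\<close>

definition half_step :: "nat \<Rightarrow> nat \<Rightarrow> (nat \<Rightarrow> nat) \<Rightarrow> nat \<Rightarrow> nat" where
  "half_step n d s = (\<lambda>j. if j mod 2 = d \<and> 1 < j \<and> j < n then chi (s (j - 1)) (s j) (s (j + 1)) else s j)"

lemma fold_upd_half_step:
  assumes "distinct xs" and set: "set xs = {j. j mod 2 = d \<and> 1 < j \<and> j < n}"
  shows "fold upd xs s = half_step n d s"
proof -
  have "y \<noteq> x + 1" if "x \<in> set xs" "y \<in> set xs" for x y
  proof -
    have "x mod 2 = d" "y mod 2 = d" using that set by auto
    then show ?thesis by presburger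
  qed
  moreover have "0 \<notin> set xs" using set by simp
  ultimately show ?thesis
    using fold_upd[OF assms(1)] by (simp add: half_step_def set)
qed

lemma local_fun_left:
  assumes "local_fun n w" "2 \<le> n"
  shows "local_fun n (\<lambda>s. \<Sum>t<2. boundary_weight a b (s 2) (s 1) t * w (s(1 := t)))"
  unfolding local_fun_def
proof (intro allI impI sum.cong refl)
  fix s s' t assume "eq_upto n s s'"
  then have "w (s(1 := t)) = w (s'(1 := t))" "s 2 = s' 2" "s 1 = s' 1"
    using assms(2) by (auto intro!: local_funD[OF assms(1)] simp: eq_upto_def)
  then show "boundary_weight a b (s 2) (s 1) t * w (s(1 := t)) = boundary_weight a b (s' 2) (s' 1) t * w (s'(1 := t))"
    by simp
qed

lemma local_fun_right:
  assumes "local_fun n w" "2 \<le> n"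
  shows "local_fun n (\<lambda>s. \<Sum>t<2. boundary_weight a b (s (n - 1)) (s n) t * w (s(n := t)))"
  unfolding local_fun_def
proof (intro allI impI sum.cong refl)
  fix s s' t assume "eq_upto n s s'"
  then have "w (s(n := t)) = w (s'(n := t))" "s (n - 1) = s' (n - 1)" "s n = s' n"
    using assms(2) by (auto intro!: local_funD[OF assms(1)] simp: eq_upto_def)
  then show "boundary_weight a b (s (n - 1)) (s n) t * w (s(n := t)) = boundary_weight a b (s' (n - 1)) (s' n) t * w (s'(n := t))"
    by simp
qed

text \<open>The bulk factors change even sites below n only, so the sites n - 1 and n read by the
  boundary weight may be taken from \<open>s\<close> itself.\<close>

lemma U_even_vecf:
  assumes n: "n = 2 * m" "2 \<le> m" and w: "local_fun n w"
  shows "U_even n a b \<in> carrier_mat (2 ^ n) (2 ^ n)"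
    and "U_even n a b *\<^sub>v vecf n w =
      vecf n (\<lambda>s. \<Sum>t<2. boundary_weight a b (s (n - 1)) (s n) t * w ((half_step n 0 s)(n := t)))"
proof -
  let ?w = "\<lambda>s. \<Sum>t<2. boundary_weight a b (s (n - 1)) (s n) t * w (s(n := t))"
  let ?xs = "map (\<lambda>l. 2 * l - 1 + 1) [1..<m]"
  have nm: "n div 2 = m" using n by simp
  have *: "U_even n a b \<in> carrier_mat (2 ^ n) (2 ^ n) \<and>
    U_even n a b *\<^sub>v vecf n w = vecf n (\<lambda>s. ?w (fold upd ?xs s))"
    unfolding U_even_def nm
    by (rule foldr_P_at_vecf[where f = "\<lambda>l. 2 * l - 1", OF P_right_at_carrier P_right_at_vecf[OF _ w] local_fun_right[OF w]])
      (use n in auto)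
  have set: "set ?xs = {j. j mod 2 = 0 \<and> 1 < j \<and> j < n}"
  proof (intro equalityI subsetI)
    fix j assume "j \<in> {j. j mod 2 = 0 \<and> 1 < j \<and> j < n}"
    then show "j \<in> set ?xs" using n by (auto intro!: image_eqI[of _ _ "j div 2"])
  qed (use n in auto)
  have "fold upd ?xs s = half_step n 0 s" for s
    by (rule fold_upd_half_step[OF _ set]) (auto simp: distinct_map inj_on_def)
  then have "vecf n (\<lambda>s. ?w (fold upd ?xs s)) =
      vecf n (\<lambda>s. \<Sum>t<2. boundary_weight a b (s (n - 1)) (s n) t * w ((half_step n 0 s)(n := t)))"
    using n by (intro vecf_eqI) (auto simp: half_step_def)
  with * show "U_even n a b \<in> carrier_mat (2 ^ n) (2 ^ n)" "U_even n a b *\<^sub>v vecf n w =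
      vecf n (\<lambda>s. \<Sum>t<2. boundary_weight a b (s (n - 1)) (s n) t * w ((half_step n 0 s)(n := t)))"
    by auto
qed

lemma U_odd_vecf:
  assumes n: "n = 2 * m" "2 \<le> m" and w: "local_fun n w"
  shows "U_odd n a b \<in> carrier_mat (2 ^ n) (2 ^ n)"
    and "U_odd n a b *\<^sub>v vecf n w =
      vecf n (\<lambda>s. \<Sum>t<2. boundary_weight a b (s 2) (s 1) t * w ((half_step n 1 s)(1 := t)))"
proof -
  let ?w = "\<lambda>s. \<Sum>t<2. boundary_weight a b (s 2) (s 1) t * w (s(1 := t))"
  let ?xs = "map (\<lambda>l. 2 * l + 1) (rev [1..<m])"
  have nm: "n div 2 = m" using n by simp
  have *: "U_odd n a b \<in> carrier_mat (2 ^ n) (2 ^ n) \<and>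
    U_odd n a b *\<^sub>v vecf n w = vecf n (\<lambda>s. ?w (fold upd ?xs s))"
    unfolding U_odd_def nm
    by (rule foldr_P_at_vecf[where f = "\<lambda>l. 2 * l", OF P_left_at_carrier P_left_at_vecf[OF _ w] local_fun_left[OF w]])
      (use n in auto)
  have set: "set ?xs = {j. j mod 2 = 1 \<and> 1 < j \<and> j < n}"
  proof (intro equalityI subsetI)
    fix j assume "j \<in> {j. j mod 2 = 1 \<and> 1 < j \<and> j < n}"
    then have j: "j mod 2 = 1" "1 < j" "j < 2 * m" using n by auto
    then have "j = 2 * (j div 2) + 1" "1 \<le> j div 2 \<and> j div 2 < m" by presburger+
    then show "j \<in> set ?xs" by (metis (no_types, lifting) atLeastLessThan_iff image_eqI list.set_map set_rev set_upt)
  qed (use n in auto)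
  have "fold upd ?xs s = half_step n 1 s" for s
    by (rule fold_upd_half_step[OF _ set]) (auto simp: distinct_map inj_on_def)
  then have "vecf n (\<lambda>s. ?w (fold upd ?xs s)) =
      vecf n (\<lambda>s. \<Sum>t<2. boundary_weight a b (s 2) (s 1) t * w ((half_step n 1 s)(1 := t)))"
    using n by (intro vecf_eqI) (auto simp: half_step_def)
  with * show "U_odd n a b \<in> carrier_mat (2 ^ n) (2 ^ n)" "U_odd n a b *\<^sub>v vecf n w =
      vecf n (\<lambda>s. \<Sum>t<2. boundary_weight a b (s 2) (s 1) t * w ((half_step n 1 s)(1 := t)))"
    by auto
qed

section \<open>The propagator is a stochastic matrix\<close>

text \<open>It is the columns that sum to one, since matrices act on column vectors.\<close>

definition stochastic_mat :: "nat \<Rightarrow> real mat \<Rightarrow> bool" where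
  "stochastic_mat N A \<longleftrightarrow> A \<in> carrier_mat N N \<and> (\<forall>i<N. \<forall>j<N. 0 \<le> A $$ (i, j)) \<and>
     (\<forall>j<N. (\<Sum>i<N. A $$ (i, j)) = 1)"

lemma stochastic_mat_one: "stochastic_mat N (1\<^sub>m N)"
  by (auto simp: stochastic_mat_def)

lemma stochastic_mat_mult:
  assumes A: "stochastic_mat N A" and B: "stochastic_mat N B"
  shows "stochastic_mat N (A * B)"
proof -
  have carrier: "A \<in> carrier_mat N N" "B \<in> carrier_mat N N"
    using A B by (auto simp: stochastic_mat_def)
  have entry: "(A * B) $$ (i, j) = (\<Sum>k<N. A $$ (i, k) * B $$ (k, j))" if "i < N" "j < N" for i j
    using carrier that by (auto simp: scalar_prod_def atLeast0LessThan)
  have "(\<Sum>i<N. (A * B) $$ (i, j)) = 1" if j: "j < N" for j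
  proof -
    have "(\<Sum>i<N. (A * B) $$ (i, j)) = (\<Sum>i<N. \<Sum>k<N. A $$ (i, k) * B $$ (k, j))"
      using entry j by simp
    also have "\<dots> = (\<Sum>k<N. \<Sum>i<N. A $$ (i, k) * B $$ (k, j))"
      by (rule sum.swap)
    also have "\<dots> = (\<Sum>k<N. (\<Sum>i<N. A $$ (i, k)) * B $$ (k, j))"
      by (simp add: sum_distrib_right)
    also have "\<dots> = 1" using A B j by (simp add: stochastic_mat_def)
    finally show ?thesis .
  qed
  moreover have "0 \<le> (A * B) $$ (i, j)" if "i < N" "j < N" for i j
    unfolding entry[OF that] using A B that by (intro sum_nonneg mult_nonneg_nonneg) (auto simp: stochastic_mat_def)
  ultimately show ?thesis using carrier by (auto simp: stochastic_mat_def)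
qed

lemma stochastic_mat_kron:
  assumes A: "stochastic_mat M A" and B: "stochastic_mat N B"
  shows "stochastic_mat (M * N) (kron A B)"
proof -
  have carrier: "A \<in> carrier_mat M M" "B \<in> carrier_mat N N"
    using A B by (auto simp: stochastic_mat_def)
  have entry: "kron A B $$ (i, j) = A $$ (i div N, j div N) * B $$ (i mod N, j mod N)"
    if "i < M * N" "j < M * N" for i j
    using carrier that by (auto simp: kron_def)
  have div_mod: "j div N < M" "j mod N < N" if "j < M * N" for j
  proof -
    have "N > 0" using that by (cases N) auto
    then show "j div N < M" "j mod N < N" using that by (auto simp: less_mult_imp_div_less)
  qed
  have "(\<Sum>i<M * N. kron A B $$ (i, j)) = 1" if j: "j < M * N" for j
  proof -
    have "(\<Sum>i<M * N. kron A B $$ (i, j)) = (\<Sum>i<M * N. A $$ (i div N, j div N) * B $$ (i mod N, j mod N))"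
      using entry j by simp
    also have "\<dots> = (\<Sum>i1<M. \<Sum>i2<N. A $$ (i1, j div N) * B $$ (i2, j mod N))"
      by (simp add: sum_lessThan_mult)
    also have "\<dots> = (\<Sum>i1<M. A $$ (i1, j div N)) * (\<Sum>i2<N. B $$ (i2, j mod N))"
      by (simp add: sum_product)
    also have "\<dots> = 1" using A B div_mod[OF j] by (simp add: stochastic_mat_def)
    finally show ?thesis .
  qed
  moreover have "0 \<le> kron A B $$ (i, j)" if "i < M * N" "j < M * N" for i j
    unfolding entry[OF that] using A B div_mod that
    by (intro mult_nonneg_nonneg) (auto simp: stochastic_mat_def)
  ultimately show ?thesis
    using kron_carrier[OF carrier] by (auto simp: stochastic_mat_def)
qed

lemma sum_lessThan_8: "(\<Sum>k<8. f k) = f 0 + f 1 + f 2 + f 3 + f 4 + f 5 + f 6 + f (7::nat)"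
  by (simp add: eval_nat_numeral add.assoc)

lemma stochastic_P_bulk: "stochastic_mat 8 P_bulk"
proof -
  have "(\<Sum>i<8. P_bulk $$ (i, j)) = 1" if "j < 8" for j
    by (rule less_8_cases[OF that]; simp add: sum_lessThan_8 P_bulk_def site_def chi_def)
  then show ?thesis
    using P_bulk_carrier by (auto simp: stochastic_mat_def P_bulk_def)
qed

lemma boundary_weight_pos:
  assumes "0 < a" "a < 1" "0 < b" "b < 1"
  shows "0 < boundary_weight a b x t s"
  using assms by (auto simp: boundary_weight_def)

lemma stochastic_P_left:
  assumes "0 < a" "a < 1" "0 < b" "b < 1"
  shows "stochastic_mat 4 (P_left a b)"
proof -
  have entry: "P_left a b $$ (i, j) = of_bool (j mod 2 = i mod 2) * boundary_weight a b (i mod 2) (i div 2) (j div 2)"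
    if "i < 4" "j < 4" for i j
    using P_left_index[of "i div 2" "i mod 2" j a b] that by auto
  have "(\<Sum>i<4. P_left a b $$ (i, j)) = 1" if j: "j < 4" for j
    by (rule less_4_cases[OF j]; simp add: sum_lessThan_4 entry boundary_weight_def)
  then show ?thesis
    using P_left_carrier less_imp_le[OF boundary_weight_pos[OF assms]] by (auto simp: stochastic_mat_def entry)
qed

lemma stochastic_P_right:
  assumes "0 < a" "a < 1" "0 < b" "b < 1"
  shows "stochastic_mat 4 (P_right a b)"
proof -
  have entry: "P_right a b $$ (i, j) = of_bool (j div 2 = i div 2) * boundary_weight a b (i div 2) (i mod 2) (j mod 2)"
    if "i < 4" "j < 4" for i j
    using P_right_index[of "i div 2" "i mod 2" j a b] that by auto
  have "(\<Sum>i<4. P_right a b $$ (i, j)) = 1" if j: "j < 4" for j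
    by (rule less_4_cases[OF j]; simp add: sum_lessThan_4 entry boundary_weight_def)
  then show ?thesis
    using P_right_carrier less_imp_le[OF boundary_weight_pos[OF assms]] by (auto simp: stochastic_mat_def entry)
qed

lemma stochastic_P_at: "1 \<le> k \<Longrightarrow> k + 2 \<le> n \<Longrightarrow> stochastic_mat (2 ^ n) (P_at n k)"
proof -
  assume k: "1 \<le> k" "k + 2 \<le> n"
  have "stochastic_mat (2 ^ (k - 1) * 8 * 2 ^ (n - k - 2)) (P_at n k)"
    unfolding P_at_def by (intro stochastic_mat_kron stochastic_mat_one stochastic_P_bulk)
  moreover have "(2::nat) ^ (k - 1) * 8 * 2 ^ (n - k - 2) = 2 ^ (k - 1 + 3 + (n - k - 2))"
    unfolding power_add by simp
  moreover have "k - 1 + 3 + (n - k - 2) = n" using k by simp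
  ultimately show ?thesis by metis
qed

lemma stochastic_foldr:
  assumes "stochastic_mat N M" "\<forall>x\<in>set xs. stochastic_mat N (f x)"
  shows "stochastic_mat N (foldr (*) (map f xs) M)"
  using assms by (induction xs) (auto intro: stochastic_mat_mult)

lemma stochastic_U_mat:
  assumes n: "n = 2 * m" "2 \<le> m"
    and "0 < \<alpha>" "\<alpha> < 1" "0 < \<beta>" "\<beta> < 1" "0 < \<gamma>" "\<gamma> < 1" "0 < \<delta>" "\<delta> < 1"
  shows "stochastic_mat (2 ^ n) (U_mat n \<alpha> \<beta> \<gamma> \<delta>)"
proof -
  have e: "(4::nat) * 2 ^ (n - 2) = 2 ^ n" "2 ^ (n - 2) * (4::nat) = 2 ^ n"
  proof -
    have "2 + (n - 2) = n" using n by simp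
    then have "(2::nat) ^ n = 2 ^ 2 * 2 ^ (n - 2)" by (metis power_add)
    then show "(4::nat) * 2 ^ (n - 2) = 2 ^ n" "2 ^ (n - 2) * (4::nat) = 2 ^ n" by simp_all
  qed
  have "stochastic_mat (4 * 2 ^ (n - 2)) (P_left_at n \<alpha> \<beta>)" "stochastic_mat (2 ^ (n - 2) * 4) (P_right_at n \<gamma> \<delta>)"
    unfolding P_left_at_def P_right_at_def using assms
    by (auto intro!: stochastic_mat_kron stochastic_mat_one stochastic_P_left stochastic_P_right)
  then have LR: "stochastic_mat (2 ^ n) (P_left_at n \<alpha> \<beta>)" "stochastic_mat (2 ^ n) (P_right_at n \<gamma> \<delta>)"
    unfolding e .
  have "n div 2 = m" using n by simp
  then show ?thesis
    unfolding U_mat_def U_even_def U_odd_def using n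
    by (intro stochastic_mat_mult stochastic_foldr LR) (auto intro!: stochastic_P_at)
qed

text \<open>A real vector fixed by a stochastic matrix has a fixed positive part, because the
  inequality \<open>A v\<^sup>+ \<ge> (A v)\<^sup>+\<close> is an equality after summation.\<close>

lemma stochastic_mat_fixed_positive_part:
  assumes A: "stochastic_mat N A" and v: "v \<in> carrier_vec N" and fixed: "A *\<^sub>v v = v"
  shows "A *\<^sub>v vec N (\<lambda>i. max 0 (v $ i)) = vec N (\<lambda>i. max 0 (v $ i))"
proof -
  have carrier: "A \<in> carrier_mat N N" using A by (simp add: stochastic_mat_def)
  define w where "w = vec N (\<lambda>i. max 0 (v $ i))"
  have w: "w \<in> carrier_vec N" "\<And>i. i < N \<Longrightarrow> w $ i = max 0 (v $ i)" by (auto simp: w_def)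
  have mult: "(A *\<^sub>v x) $ i = (\<Sum>j<N. A $$ (i, j) * x $ j)" if "i < N" "x \<in> carrier_vec N" for i x
    using carrier that by (auto simp: scalar_prod_def atLeast0LessThan)
  have ge: "w $ i \<le> (A *\<^sub>v w) $ i" if i: "i < N" for i
  proof -
    have "0 \<le> (\<Sum>j<N. A $$ (i, j) * w $ j)"
      using A i w by (intro sum_nonneg) (auto simp: stochastic_mat_def)
    moreover have "(\<Sum>j<N. A $$ (i, j) * v $ j) \<le> (\<Sum>j<N. A $$ (i, j) * w $ j)"
      using A i w by (intro sum_mono mult_left_mono) (auto simp: stochastic_mat_def)
    moreover have "(\<Sum>j<N. A $$ (i, j) * v $ j) = v $ i"
      using mult[OF i v] fixed by simp
    ultimately show ?thesis using mult[OF i w(1)] w(2)[OF i] by simp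
  qed
  have "(\<Sum>i<N. (A *\<^sub>v w) $ i) = (\<Sum>i<N. \<Sum>j<N. A $$ (i, j) * w $ j)"
    using mult w by simp
  also have "\<dots> = (\<Sum>j<N. \<Sum>i<N. A $$ (i, j) * w $ j)" by (rule sum.swap)
  also have "\<dots> = (\<Sum>j<N. (\<Sum>i<N. A $$ (i, j)) * w $ j)" by (simp add: sum_distrib_right)
  also have "\<dots> = (\<Sum>j<N. w $ j)" using A by (simp add: stochastic_mat_def)
  finally have "(\<Sum>i<N. (A *\<^sub>v w) $ i - w $ i) = 0" by (simp add: sum_subtractf)
  then have "\<forall>i\<in>{..<N}. (A *\<^sub>v w) $ i - w $ i = 0"
    by (subst (asm) sum_nonneg_eq_0_iff) (use ge in auto)
  then have "A *\<^sub>v w = w"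
    using carrier w by (intro eq_vecI) auto
  then show ?thesis by (simp add: w_def)
qed

section \<open>Steering any configuration into the vacuum\<close>

definition free_site :: "nat \<Rightarrow> nat \<Rightarrow> nat" where
  "free_site n d = (if d = 0 then n else 1)"

text \<open>\<open>V 0\<close> and \<open>V 1\<close> are the supports before the even and before the odd half step; any
  value of the free boundary site is reached with positive probability.\<close>

definition closed_support :: "nat \<Rightarrow> (nat \<Rightarrow> (nat \<Rightarrow> nat) \<Rightarrow> bool) \<Rightarrow> bool" where
  "closed_support n V \<longleftrightarrow> (\<forall>d s c. d < 2 \<longrightarrow> bits n s \<longrightarrow> V d s \<longrightarrow> c < 2 \<longrightarrow>
     V (1 - d) ((half_step n d s)(free_site n d := c)))"

text \<open>The first \<open>r\<close> sites carry left-moving solitons only, seen just before the sites of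
  the parity of \<open>r\<close> are updated: solitons are pairs of ones on \<open>x - 1, x\<close>, and adjacent
  pairs are excluded as they would be a collision. The region grows, since no right-mover is
  emitted into it.\<close>

definition region :: "nat \<Rightarrow> (nat \<Rightarrow> nat) \<Rightarrow> bool" where
  "region r s \<longleftrightarrow> (\<forall>x. 2 \<le> x \<and> x \<le> r \<and> x mod 2 = r mod 2 \<longrightarrow> s (x - 1) = s x) \<and>
     (\<forall>x. 3 \<le> x \<and> x \<le> r \<and> x mod 2 = r mod 2 \<longrightarrow> \<not> (s (x - 2) = 1 \<and> s x = 1))"

lemma regionD1: "region r s \<Longrightarrow> 2 \<le> x \<Longrightarrow> x \<le> r \<Longrightarrow> x mod 2 = r mod 2 \<Longrightarrow> s (x - 1) = s x"
  by (simp add: region_def)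

lemma regionD2: "region r s \<Longrightarrow> 3 \<le> x \<Longrightarrow> x \<le> r \<Longrightarrow> x mod 2 = r mod 2 \<Longrightarrow> s (x - 2) = 1 \<Longrightarrow> s x \<noteq> 1"
  by (simp add: region_def)

lemma bits_half_step: "bits n s \<Longrightarrow> c < 2 \<Longrightarrow> bits n ((half_step n d s)(e := c))"
  by (auto simp: bits_def half_step_def chi_less_2)

lemma half_step_unchanged: "even n \<Longrightarrow> d < 2 \<Longrightarrow> x mod 2 \<noteq> d \<Longrightarrow> ((half_step n d s)(free_site n d := c)) x = s x"
  by (auto simp: half_step_def free_site_def even_iff_mod_2_eq_zero)

lemma bitsD: "bits n s \<Longrightarrow> 1 \<le> j \<Longrightarrow> j \<le> n \<Longrightarrow> s j < 2"
  by (simp add: bits_def)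

lemma Suc_mod_2_neq: "Suc x mod 2 \<noteq> x mod 2"
  by (simp add: mod_Suc)

lemma pred_mod_2: "1 \<le> (x::nat) \<Longrightarrow> x mod 2 \<noteq> y mod 2 \<Longrightarrow> (x - 1) mod 2 = y mod 2"
  by (cases x) (auto simp: mod_Suc mod2_eq_if split: if_splits)

text \<open>A site with value a, an equal left neighbour and right neighbour b becomes
  \<open>chi a a b\<close>, which is b unless a = b = 1; so each pair advances one site to the left.
  The exception is ruled out inside the region by its second condition (\<open>no_two\<close>) and
  at its end by \<open>front\<close>. At the left end the free site 1 has to copy site 2.\<close>

lemma region_step:
  assumes R: "region r s" and s: "bits n s" and n: "even n"
    and r': "r' \<le> r + 1" "r' mod 2 \<noteq> r mod 2" "r' \<le> n"
    and front: "r' = r + 1 \<Longrightarrow> r \<ge> 1 \<Longrightarrow> \<not> (s r = 1 \<and> s (r + 1) = 1)"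
    and c: "r mod 2 = 1 \<Longrightarrow> 2 \<le> r' \<Longrightarrow> c = s 2"
  shows "region r' ((half_step n (r mod 2) s)(free_site n (r mod 2) := c))"
    (is "region r' ?s")
proof -
  have no_two: "\<not> (s y = 1 \<and> s (y + 1) = 1)" if y: "1 \<le> y" "y + 1 \<le> r'" "y mod 2 = r mod 2" for y
  proof (cases "y = r")
    case True
    then show ?thesis using front y r' by simp
  next
    case False
    have "y + 1 \<noteq> r" using y(3) Suc_mod_2_neq[of y] by auto
    then have "y + 2 \<le> r" using y r'(1) False by linarith
    moreover have "(y + 2) mod 2 = r mod 2" using y by simp
    ultimately show ?thesis
      using regionD1[OF R, of "y + 2"] regionD2[OF R, of "y + 2"] y by auto
  qed
  have same: "?s x = s x" if "x mod 2 \<noteq> r mod 2" for x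
    by (rule half_step_unchanged) (use n that in auto)
  have pair: "?s (x - 1) = s x" if x: "2 \<le> x" "x \<le> r'" "x mod 2 = r' mod 2" for x
  proof -
    have par: "(x - 1) mod 2 = r mod 2" using x r'(2) by (intro pred_mod_2) auto
    have xr: "x - 1 \<le> r" using x r' by simp
    show ?thesis
    proof (cases "x = 2")
      case True
      then have "r mod 2 = 1" using par by simp
      then show ?thesis using True c x by (simp add: free_site_def)
    next
      case False
      have "x - 1 \<noteq> free_site n (r mod 2)" "1 < x - 1" "x - 1 < n"
        using x r' False by (auto simp: free_site_def)
      then have "?s (x - 1) = chi (s (x - 1 - 1)) (s (x - 1)) (s x)"
        using par x by (simp add: half_step_def)
      also have "s (x - 1 - 1) = s (x - 1)"
        by (rule regionD1[OF R]) (use False x xr par in auto)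
      also have "chi (s (x - 1)) (s (x - 1)) (s x) = s x"
      proof -
        have "s (x - 1) < 2" "s x < 2"
          using bitsD[OF s, of "x - 1"] bitsD[OF s, of x] x r' by auto
        moreover have "\<not> (s (x - 1) = 1 \<and> s x = 1)" using no_two[of "x - 1"] x par by simp
        ultimately show ?thesis
          by (auto elim!: less_2_cases simp: chi_def)
      qed
      finally show ?thesis .
    qed
  qed
  show ?thesis
    unfolding region_def
  proof (intro conjI allI impI)
    fix x assume x: "2 \<le> x \<and> x \<le> r' \<and> x mod 2 = r' mod 2"
    then show "?s (x - 1) = ?s x" using pair[of x] same[of x] r' by simp
  next
    fix x assume x: "3 \<le> x \<and> x \<le> r' \<and> x mod 2 = r' mod 2"
    have p: "(x - 2) mod 2 \<noteq> r mod 2" "(x - 1) mod 2 = r mod 2" "x mod 2 \<noteq> r mod 2"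
    proof -
      show x0: "x mod 2 \<noteq> r mod 2" using x r'(2) by simp
      show x1: "(x - 1) mod 2 = r mod 2" using x x0 by (intro pred_mod_2) auto
      have "x - 1 = Suc (x - 2)" using x by arith
      then show "(x - 2) mod 2 \<noteq> r mod 2" using x1 Suc_mod_2_neq[of "x - 2"] by simp
    qed
    have "s (x - 1 - 1) = s (x - 1)"
    proof (rule regionD1[OF R])
      show "2 \<le> x - 1" "x - 1 \<le> r" using x r'(1) by linarith+
    qed (fact p(2))
    then have "s (x - 2) = s (x - 1)" by (simp add: numeral_2_eq_2)
    moreover have "1 \<le> x - 1" using x by linarith
    then have "\<not> (s (x - 1) = 1 \<and> s x = 1)" using no_two[of "x - 1"] x p by simp
    moreover have "?s (x - 2) = s (x - 2)" "?s x = s x" using same p by auto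
    ultimately show "\<not> (?s (x - 2) = 1 \<and> ?s x = 1)" by metis
  qed
qed

lemma closed_supportD:
  "closed_support n V \<Longrightarrow> bits n s \<Longrightarrow> V (r mod 2) s \<Longrightarrow> c < 2 \<Longrightarrow> r' mod 2 \<noteq> r mod 2 \<Longrightarrow>
    V (r' mod 2) ((half_step n (r mod 2) s)(free_site n (r mod 2) := c))"
proof -
  assume a: "closed_support n V" "bits n s" "V (r mod 2) s" "c < 2" "r' mod 2 \<noteq> r mod 2"
  have "r' mod 2 = 1 - r mod 2" using a(5) by (auto simp: mod2_eq_if split: if_splits)
  then show ?thesis using a by (simp add: closed_support_def)
qed

text \<open>If ones on r and r + 1 block the front, two extra half steps clear it: the region
  retreats to r - 1 and returns to r with site r equal to zero, after which the ordinary growth step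
  applies.\<close>

lemma region_grow:
  assumes V: "closed_support n V" and n: "even n" "2 \<le> n"
    and s: "bits n s" "V (r mod 2) s" "region r s" and r: "r < n"
  shows "\<exists>s'. bits n s' \<and> V ((r + 1) mod 2) s' \<and> region (r + 1) s'"
proof -
  have grow: "\<exists>s'. bits n s' \<and> V ((r + 1) mod 2) s' \<and> region (r + 1) s'"
    if "bits n s" "V (r mod 2) s" "region r s" "r < n" "r \<ge> 1 \<Longrightarrow> \<not> (s r = 1 \<and> s (r + 1) = 1)" for r s
  proof -
    \<comment> \<open>For odd r the free site is 1 and must copy site 2. For even r it is n, which
      lies outside the enlarged region, and \<open>s 2\<close> merely supplies some bit.\<close>
    let ?s = "(half_step n (r mod 2) s)(free_site n (r mod 2) := s 2)"
    have p: "(r + 1) mod 2 \<noteq> r mod 2" using Suc_mod_2_neq by simp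
    have c: "s 2 < 2" using that(1) n by (simp add: bits_def)
    have "V ((r + 1) mod 2) ?s" by (rule closed_supportD[OF V, OF that(1,2) c p])
    moreover have "region (r + 1) ?s"
      by (rule region_step[OF that(3,1) n(1)]) (use that p in auto)
    ultimately show ?thesis using bits_half_step[OF that(1) c] by blast
  qed
  show ?thesis
  proof (cases "r \<ge> 1 \<and> s r = 1 \<and> s (r + 1) = 1")
    case False
    then show ?thesis using grow[OF s r] by blast
  next
    case True
    \<comment> \<open>For r = 1 the blocking site is the free one and is set to zero directly. For
      larger r the sites r - 1, r, r + 1 all carry a one, and the update annihilates the middle
      one.\<close>
    define c where "c = (if r = 1 then 0 else s 2)"
    define s1 where "s1 = (half_step n (r mod 2) s)(free_site n (r mod 2) := c)"
    have c: "c < 2" using s(1) n by (simp add: bits_def c_def)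
    have r1: "1 \<le> r" using True by simp
    then have p: "(r - 1) mod 2 \<noteq> r mod 2" using Suc_mod_2_neq[of "r - 1"] by simp
    have R1: "region (r - 1) s1" unfolding s1_def
      by (rule region_step[OF s(3,1) n(1)]) (use True r p in \<open>auto simp: c_def\<close>)
    have V1: "V ((r - 1) mod 2) s1" unfolding s1_def by (rule closed_supportD[OF V, OF s(1,2) c p])
    have B1: "bits n s1" unfolding s1_def by (rule bits_half_step[OF s(1) c])
    have z1: "s1 r = 0"
    proof (cases "r = 1")
      case True
      then show ?thesis by (simp add: s1_def free_site_def c_def)
    next
      case False
      have "s (r - 1) = s r" by (rule regionD1[OF s(3)]) (use True False in auto)
      then show ?thesis using True False r
        by (simp add: s1_def free_site_def half_step_def chi_def)
    qed
    define s2 where "s2 = (half_step n ((r - 1) mod 2) s1)(free_site n ((r - 1) mod 2) := s1 2)"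
    have c2: "s1 2 < 2" using B1 n by (simp add: bits_def)
    have R2: "region r s2" unfolding s2_def
      by (rule region_step[OF R1 B1 n(1)]) (use True r p z1 in auto)
    have V2: "V (r mod 2) s2" unfolding s2_def by (rule closed_supportD[OF V, OF B1 V1 c2]) (use p in simp)
    have B2: "bits n s2" unfolding s2_def by (rule bits_half_step[OF B1 c2])
    have "s2 r = s1 r" unfolding s2_def
      by (rule half_step_unchanged) (use n p in auto)
    then show ?thesis using grow[OF B2 V2 R2 r] z1 by simp
  qed
qed

lemma region_full:
  assumes V: "closed_support n V" and n: "even n" "2 \<le> n" and s: "bits n s" "V 0 s" and r: "r \<le> n"
  shows "\<exists>s'. bits n s' \<and> V (r mod 2) s' \<and> region r s'"
  using r
proof (induction r)
  case 0
  then show ?case using s by (auto simp: region_def)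
next
  case (Suc r)
  then obtain s' where s': "bits n s'" "V (r mod 2) s'" "region r s'"
    by (meson Suc_leD)
  have "r < n" using Suc.prems by simp
  from region_grow[OF V, OF n s' this] show ?case by simp
qed

text \<open>A site that agrees with its left neighbour and has a zero to its right becomes
  \<open>chi a a 0 = 0\<close>, so each half step lengthens the zero tail by one site. Setting site
  n to zero lets no soliton in on the right; letting site 1 copy site 2 sends none back from the
  left. The value z = n + 1 is the empty tail.\<close>

lemma region_shift:
  assumes V: "closed_support n V" and n: "even n" "2 \<le> n"
    and s: "bits n s" "V 0 s" "region n s" and z: "3 \<le> z" "z \<le> n + 1" "odd z"
    and zero: "\<And>x. z \<le> x \<Longrightarrow> x \<le> n \<Longrightarrow> s x = 0"
  shows "\<exists>s'. bits n s' \<and> V 0 s' \<and> region n s' \<and> (\<forall>x. z - 2 \<le> x \<and> x \<le> n \<longrightarrow> s' x = 0)"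
proof -
  have n0: "n mod 2 = 0" using n by (simp add: even_iff_mod_2_eq_zero)
  moreover have "Suc (n - 1) = n" using n by simp
  ultimately have "(n - 1) mod 2 \<noteq> 0" using Suc_mod_2_neq[of "n - 1"] by simp
  with n0 have n0: "n mod 2 = 0" "(n - 1) mod 2 = 1" "(n - Suc 0) mod 2 = 1" by auto
  define s1 where "s1 = (half_step n (n mod 2) s)(free_site n (n mod 2) := 0)"
  have B1: "bits n s1" unfolding s1_def by (rule bits_half_step[OF s(1)]) simp
  have V1: "V ((n - 1) mod 2) s1" unfolding s1_def
    by (rule closed_supportD[OF V, OF s(1)]) (use s n0 in auto)
  have R1: "region (n - 1) s1" unfolding s1_def
    by (rule region_step[OF s(3,1) n(1)]) (use n0 in auto)
  have z1: "s1 x = 0" if x: "z - 1 \<le> x" "x \<le> n" for x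
  proof -
    consider "x = n" | "odd x" | "even x" "x < n" using x by linarith
    then show ?thesis
    proof cases
      case 1
      then show ?thesis by (simp add: s1_def free_site_def n0)
    next
      case 2
      then have "s1 x = s x" unfolding s1_def
        by (intro half_step_unchanged) (use n n0 in \<open>auto simp: odd_iff_mod_2_eq_one\<close>)
      moreover have "x \<noteq> z - 1" using 2 z by auto
      then have "z \<le> x" using x by linarith
      ultimately show ?thesis using zero x by simp
    next
      case 3
      have x1: "1 < x" "x mod 2 = 0" using x z 3 by auto
      have "s (x - 1) = s x" by (rule regionD1[OF s(3)]) (use x1 x n0 in auto)
      moreover have "s (x + 1) = 0" using zero x 3 by simp
      moreover have "s x < 2" using s(1) x1 x by (simp add: bits_def)
      ultimately show ?thesis using x1 3
        by (auto simp: s1_def free_site_def n0 half_step_def chi_def)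
    qed
  qed
  define s2 where "s2 = (half_step n ((n - 1) mod 2) s1)(free_site n ((n - 1) mod 2) := s1 2)"
  have c2: "s1 2 < 2" using B1 n by (simp add: bits_def)
  have B2: "bits n s2" unfolding s2_def by (rule bits_half_step[OF B1 c2])
  have V2: "V (n mod 2) s2" unfolding s2_def by (rule closed_supportD[OF V, OF B1 V1 c2]) (use n0 in simp)
  have R2: "region n s2" unfolding s2_def
    by (rule region_step[OF R1 B1 n(1)]) (use n n0 z1[of n] z in auto)
  have z2: "s2 x = 0" if x: "z - 2 \<le> x" "x \<le> n" for x
  proof -
    consider "x = 1" | "even x" | "odd x" "1 < x" using x z by linarith
    then show ?thesis
    proof cases
      case 1
      then have "z = 3" using x z by simp
      then show ?thesis using 1 z1[of 2] n by (simp add: s2_def free_site_def n0)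
    next
      case 2
      then have "s2 x = s1 x" unfolding s2_def
        by (intro half_step_unchanged) (use n n0 in auto)
      moreover have "x \<noteq> z - 2" using 2 z by auto
      then have "z - 1 \<le> x" using x by linarith
      ultimately show ?thesis using z1 x by simp
    next
      case 3
      have x1: "x < n" "x mod 2 = 1" using x 3 n by (auto simp: odd_iff_mod_2_eq_one le_less)
      have "s1 (x - 1) = s1 x" by (rule regionD1[OF R1]) (use x1 3 n0 in auto)
      moreover have "s1 (x + 1) = 0" using z1[of "x + 1"] x x1 by simp
      moreover have "s1 x < 2" using B1 x1 3 by (simp add: bits_def)
      ultimately show ?thesis using x1 3
        by (auto simp: s2_def free_site_def n0 half_step_def chi_def)
    qed
  qed
  from B2 V2 R2 z2 n0 show ?thesis by auto
qed

lemma vacuum_reachable: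
  assumes V: "closed_support n V" and n: "even n" "2 \<le> n" and s: "bits n s" "V 0 s"
  shows "\<exists>s'. bits n s' \<and> V 0 s' \<and> (\<forall>x. 1 \<le> x \<and> x \<le> n \<longrightarrow> s' x = 0)"
proof -
  have "\<exists>s'. bits n s' \<and> V 0 s' \<and> region n s' \<and> (\<forall>x. n + 1 - 2 * k \<le> x \<and> x \<le> n \<longrightarrow> s' x = 0)"
    if "2 * k \<le> n" for k
    using that
  proof (induction k)
    case 0
    then show ?case using region_full[OF V, OF n s, of n] n by (auto simp: even_iff_mod_2_eq_zero)
  next
    case (Suc k)
    then obtain s' where s': "bits n s'" "V 0 s'" "region n s'"
      "\<And>x. n + 1 - 2 * k \<le> x \<Longrightarrow> x \<le> n \<Longrightarrow> s' x = 0" by auto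
    have "n + 1 - 2 * k - 2 = n + 1 - 2 * Suc k" by simp
    moreover have "3 \<le> n + 1 - 2 * k" "odd (n + 1 - 2 * k)" using Suc.prems n by auto
    ultimately show ?case using region_shift[OF V, OF n s'(1-3), of "n + 1 - 2 * k"] s'(4) by auto
  qed
  from this[of "n div 2"] n show ?thesis by auto
qed

section \<open>Uniqueness of the steady state\<close>

lemma half_step_cong: "eq_upto n s s' \<Longrightarrow> 1 \<le> j \<Longrightarrow> j \<le> n \<Longrightarrow> half_step n d s j = half_step n d s' j"
proof -
  assume e: "eq_upto n s s'" and j: "1 \<le> j" "j \<le> n"
  have eq: "s i = s' i" if "1 \<le> i" "i \<le> n" for i using e that by (simp add: eq_upto_def)
  show ?thesis
    using eq[of "j - 1"] eq[of j] eq[of "j + 1"] j by (auto simp: half_step_def)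
qed

text \<open>Neighbours of an updated site have the other parity and are unchanged, so
  \<open>chi_chi\<close> applies at every site at once, and the free site is restored explicitly.
  This exhibits \<open>s\<close> as a predecessor of its image for every choice of
  \<open>c\<close>.\<close>

lemma half_step_inverse:
  assumes "even n" "d < 2" "bits n s" "1 \<le> j" "j \<le> n"
  shows "((half_step n d ((half_step n d s)(free_site n d := c)))(free_site n d := s (free_site n d))) j = s j"
proof (cases "j mod 2 = d \<and> 1 < j \<and> j < n")
  case True
  let ?s = "(half_step n d s)(free_site n d := c)"
  have "(j - 1) mod 2 \<noteq> d" "(j + 1) mod 2 \<noteq> d"
    using True Suc_mod_2_neq[of "j - 1"] Suc_mod_2_neq[of j] by auto
  then have "?s (j - 1) = s (j - 1)" "?s (j + 1) = s (j + 1)"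
    using half_step_unchanged[OF assms(1,2)] by blast+
  moreover have "j \<noteq> free_site n d" using True by (auto simp: free_site_def)
  moreover have "s j < 2" using assms by (simp add: bits_def)
  ultimately show ?thesis using True by (simp add: half_step_def chi_chi)
next
  case False
  then show ?thesis by (auto simp: half_step_def)
qed

text \<open>With \<open>f\<close>, \<open>g\<close>, \<open>h\<close> the weights before, halfway
  through and after a time step, the sum defining the new weight of an image contains the old weight
  of \<open>s\<close> with a positive coefficient and has no negative terms. So positivity spreads
  along all transitions, and \<open>h = f\<close> on configurations closes the cycle.\<close>

lemma fixed_vec_vacuum_pos:
  assumes n: "n = 2 * m" "2 \<le> m"
    and ab: "0 < \<alpha>" "\<alpha> < 1" "0 < \<beta>" "\<beta> < 1" "0 < \<gamma>" "\<gamma> < 1" "0 < \<delta>" "\<delta> < 1"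
    and w: "w \<in> carrier_vec (2 ^ n)" "\<And>i. i < 2 ^ n \<Longrightarrow> 0 \<le> w $ i"
    and fixed: "U_mat n \<alpha> \<beta> \<gamma> \<delta> *\<^sub>v w = w" and i: "i < 2 ^ n" "0 < w $ i"
  shows "0 < w $ 0"
proof -
  define f where "f = (\<lambda>s. w $ enc n s)"
  define g where "g = (\<lambda>s. \<Sum>t<2. boundary_weight \<gamma> \<delta> (s (n - 1)) (s n) t * f ((half_step n 0 s)(n := t)))"
  define h where "h = (\<lambda>s. \<Sum>t<2. boundary_weight \<alpha> \<beta> (s 2) (s 1) t * g ((half_step n 1 s)(1 := t)))"
  have lf: "local_fun n f" unfolding f_def by (rule local_fun_enc)
  have lg: "local_fun n g"
    unfolding local_fun_def
  proof (intro allI impI)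
    fix s s' :: "nat \<Rightarrow> nat" assume e: "eq_upto n s s'"
    note hs = half_step_cong[OF e, of _ 0]
    have "s (n - 1) = s' (n - 1)" "s n = s' n" using e n by (auto simp: eq_upto_def)
    moreover have "f ((half_step n 0 s)(n := t)) = f ((half_step n 0 s')(n := t))" for t
      by (rule local_funD[OF lf]) (use hs in auto)
    ultimately show "g s = g s'" by (simp add: g_def)
  qed
  have wf: "w = vecf n f" unfolding f_def by (rule vecf_enc[OF w(1)])
  have "U_mat n \<alpha> \<beta> \<gamma> \<delta> *\<^sub>v w = U_odd n \<alpha> \<beta> *\<^sub>v (U_even n \<gamma> \<delta> *\<^sub>v w)"
    unfolding U_mat_def
    by (rule assoc_mult_mat_vec[OF U_odd_vecf(1)[OF n lf] U_even_vecf(1)[OF n lf] w(1)])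
  also have "\<dots> = vecf n h"
    unfolding wf U_even_vecf(2)[OF n lf] using U_odd_vecf(2)[OF n lg] by (simp add: g_def h_def)
  finally have wh: "w = vecf n h" using fixed by simp
  have hf: "h s = f s" if "bits n s" for s
  proof -
    have "local_fun n h"
      unfolding local_fun_def
    proof (intro allI impI)
      fix s s' :: "nat \<Rightarrow> nat" assume e: "eq_upto n s s'"
      note hs = half_step_cong[OF e, of _ 1]
      have "s 1 = s' 1" "s 2 = s' 2" using e n by (auto simp: eq_upto_def)
      moreover have "g ((half_step n 1 s)(1 := t)) = g ((half_step n 1 s')(1 := t))" for t
        by (rule local_funD[OF lg]) (use hs in auto)
      ultimately show "h s = h s'" by (simp add: h_def)
    qed
    then show ?thesis using vecf_index_enc[OF _ that] wh by (simp add: f_def)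
  qed
  have f0: "0 \<le> f s" if "bits n s" for s using w(2) enc_less[OF that] by (simp add: f_def)
  note bp = boundary_weight_pos[OF ab(1-4)] boundary_weight_pos[OF ab(5-8)]
  have g0: "0 \<le> g s" if "bits n s" for s unfolding g_def
    using that by (intro sum_nonneg mult_nonneg_nonneg f0 bits_half_step less_imp_le[OF bp(2)]) auto
  define V where "V = (\<lambda>(d::nat) s. if d = 0 then 0 < f s else 0 < g s)"
  have "closed_support n V"
    unfolding closed_support_def
  proof (intro allI impI)
    fix d c :: nat and s :: "nat \<Rightarrow> nat"
    assume d: "d < 2" and s: "bits n s" and Vs: "V d s" and c: "c < 2"
    let ?e = "free_site n d"
    let ?s = "(half_step n d s)(?e := c)"
    let ?b = "if d = 0 then boundary_weight \<gamma> \<delta> (?s (n - 1)) (?s n) else boundary_weight \<alpha> \<beta> (?s 2) (?s 1)"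
    let ?f = "if d = 0 then f else g"
    have B: "bits n ?s" by (rule bits_half_step[OF s c])
    have e: "s ?e < 2" using s n by (auto simp: bits_def free_site_def)
    have lF: "local_fun n ?f" using lf lg by simp
    have "?f ((half_step n d ?s)(?e := s ?e)) = ?f s"
      by (rule local_funD[OF lF half_step_inverse]) (use n d s in auto)
    then have pos: "0 < ?f ((half_step n d ?s)(?e := s ?e))" using Vs by (simp add: V_def split: if_splits)
    have nn: "0 \<le> ?f ((half_step n d ?s)(?e := t))" if "t < 2" for t
      using f0[OF bits_half_step[OF B that, of d ?e]] g0[OF bits_half_step[OF B that, of d ?e]]
      by (cases "d = 0") simp_all
    have "0 < (\<Sum>t<2. ?b t * ?f ((half_step n d ?s)(?e := t)))"
    proof (rule sum_pos2[of _ "s ?e"])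
      show "0 < ?b (s ?e) * ?f ((half_step n d ?s)(?e := s ?e))" using pos bp by simp
      show "0 \<le> ?b t * ?f ((half_step n d ?s)(?e := t))" if "t \<in> {..<2}" for t
        using nn that less_imp_le[OF bp(1)] less_imp_le[OF bp(2)] by simp
    qed (use e in auto)
    also have "(\<Sum>t<2. ?b t * ?f ((half_step n d ?s)(?e := t))) = (if d = 0 then g ?s else h ?s)"
    proof (cases "d = 0")
      case True
      then show ?thesis by (simp add: g_def free_site_def)
    next
      case False
      then have "d = 1" using d by simp
      then show ?thesis by (simp add: h_def free_site_def)
    qed
    finally show "V (1 - d) ?s" using d hf[OF B] by (auto simp: V_def)
  qed
  moreover have "V 0 (site n i)" using i by (simp add: V_def f_def enc_site)
  ultimately obtain s where s: "bits n s" "V 0 s" "\<And>x. 1 \<le> x \<Longrightarrow> x \<le> n \<Longrightarrow> s x = 0"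
    using vacuum_reachable[of n V "site n i"] n bits_site by auto
  have "enc n s = enc n (site n 0)"
    by (rule enc_cong) (use s in \<open>auto simp: eq_upto_def site_def\<close>)
  then have "enc n s = 0" by (simp add: enc_site)
  then show ?thesis using s(2) by (simp add: V_def f_def)
qed

lemma steady_state_unique:
  assumes n: "n = 2 * m" "2 \<le> m"
    and ab: "0 < \<alpha>" "\<alpha> < 1" "0 < \<beta>" "\<beta> < 1" "0 < \<gamma>" "\<gamma> < 1" "0 < \<delta>" "\<delta> < 1"
    and p: "steady_state n \<alpha> \<beta> \<gamma> \<delta> p" and q: "steady_state n \<alpha> \<beta> \<gamma> \<delta> q"
  shows "p = q"
proof -
  let ?U = "U_mat n \<alpha> \<beta> \<gamma> \<delta>"
  have U: "stochastic_mat (2 ^ n) ?U" by (rule stochastic_U_mat[OF n ab])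
  then have Uc: "?U \<in> carrier_mat (2 ^ n) (2 ^ n)" by (simp add: stochastic_mat_def)
  have c: "p \<in> carrier_vec (2 ^ n)" "q \<in> carrier_vec (2 ^ n)"
    using p q by (auto simp: steady_state_def probability_vector_def)
  have le: "\<exists>i<2 ^ n. p $ i - q $ i \<le> 0"
    if "steady_state n \<alpha> \<beta> \<gamma> \<delta> p" "steady_state n \<alpha> \<beta> \<gamma> \<delta> q" for p q
  proof (rule ccontr)
    assume "\<not> ?thesis"
    then have "(\<Sum>i<2 ^ n. q $ i) < (\<Sum>i<2 ^ n. p $ i)"
      by (intro sum_strict_mono) (auto simp: not_le lessThan_empty_iff)
    then show False using that by (simp add: steady_state_def probability_vector_def)
  qed
  have pos: "0 < p $ 0 - q $ 0"
    if ss: "steady_state n \<alpha> \<beta> \<gamma> \<delta> p" "steady_state n \<alpha> \<beta> \<gamma> \<delta> q" and i: "i < 2 ^ n" "0 < p $ i - q $ i" for p q i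
  proof -
    have c: "p \<in> carrier_vec (2 ^ n)" "q \<in> carrier_vec (2 ^ n)" "?U *\<^sub>v p = p" "?U *\<^sub>v q = q"
      using ss by (auto simp: steady_state_def probability_vector_def)
    have fixed: "?U *\<^sub>v (p - q) = p - q"
      using mult_minus_distrib_mat_vec[OF Uc c(1,2)] c by simp
    let ?w = "vec (2 ^ n) (\<lambda>i. max 0 ((p - q) $ i))"
    have "?U *\<^sub>v ?w = ?w"
      by (rule stochastic_mat_fixed_positive_part[OF U _ fixed]) (use c in simp)
    then have "0 < ?w $ 0"
      by (intro fixed_vec_vacuum_pos[OF n ab, of ?w i]) (use i c in auto)
    then show ?thesis using c by simp
  qed
  have le': "p $ i \<le> q $ i" if pq: "steady_state n \<alpha> \<beta> \<gamma> \<delta> p" "steady_state n \<alpha> \<beta> \<gamma> \<delta> q" and i: "i < 2 ^ n" for p q i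
  proof (rule ccontr)
    assume "\<not> p $ i \<le> q $ i"
    then have p0: "0 < p $ 0 - q $ 0" using pos[OF pq i] by simp
    \<comment> \<open>A positive entry of \<open>q - p\<close> anywhere would make
      \<open>q - p\<close> positive at the vacuum too, against \<open>p0\<close>. So
      \<open>p - q\<close> is nonnegative everywhere and positive at the vacuum, which contradicts
      the equal total masses.\<close>
    have no_pos: "\<not> 0 < q $ j - p $ j" if "j < 2 ^ n" for j
      using pos[OF pq(2,1) that] p0 by auto
    have "(\<Sum>j<2 ^ n. p $ j - q $ j) = 0"
      using pq by (simp add: steady_state_def probability_vector_def sum_subtractf)
    moreover have "0 < (\<Sum>j<2 ^ n. p $ j - q $ j)"
      by (rule sum_pos2[of _ 0]) (use p0 no_pos in \<open>auto simp: not_less\<close>)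
    ultimately show False by simp
  qed
  show ?thesis
    using c le'[OF p q] le'[OF q p] by (intro eq_vecI) (auto intro: antisym)
qed

section \<open>Chains with memory two and their pair marginals\<close>

definition bern :: "real \<Rightarrow> nat \<Rightarrow> real" where
  "bern q z = (if z = 0 then 1 - q else q)"

text \<open>Law of a site given its predecessors \<open>x\<close> and \<open>y\<close>, where
  \<open>q\<close> belongs to the parity of the generated site and \<open>q'\<close> to the opposite
  one. The three cases are matched to two requirements: invariance under bulk updates
  (\<open>kap_exchange\<close>) and consistency of the pair marginals
  (\<open>sum_pair_weight_kap\<close>).\<close>

definition kap :: "real \<Rightarrow> real \<Rightarrow> nat \<Rightarrow> nat \<Rightarrow> nat \<Rightarrow> real" where
  "kap q q' x y = bern (if y = 0 then q else if x = 0 then 1 - q else q')"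

text \<open>The stationary weight of two consecutive sites, of total mass \<open>1 + q + q'\<close>.\<close>

definition pair_weight :: "real \<Rightarrow> real \<Rightarrow> nat \<Rightarrow> nat \<Rightarrow> real" where
  "pair_weight q q' x y = (if x = 0 \<and> y = 0 then 1 - q else if x = 0 \<or> y = 0 then q else q')"

text \<open>The first three sites feel the left boundary and get a joint law \<open>f\<close> of
  their own; from site 4 on \<open>kap\<close> takes over. The last site n is never part of a chain,
  as its law is imposed by the right boundary.\<close>

definition chain :: "real \<Rightarrow> real \<Rightarrow> (nat \<Rightarrow> nat \<Rightarrow> nat \<Rightarrow> real) \<Rightarrow> nat \<Rightarrow> (nat \<Rightarrow> nat) \<Rightarrow> real" where
  "chain q q' f N s = f (s 1) (s 2) (s 3) *
     (\<Prod>k\<in>{4..N}. (if even k then kap q q' else kap q' q) (s (k - 2)) (s (k - 1)) (s k))"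

lemma bern_nonneg: "0 \<le> q \<Longrightarrow> q \<le> 1 \<Longrightarrow> 0 \<le> bern q z"
  by (simp add: bern_def)

lemma sum_bern: "(\<Sum>z<2. bern q z) = 1"
  by (simp add: sum_lessThan_2 bern_def)

lemma kap_nonneg: "0 \<le> q \<Longrightarrow> q \<le> 1 \<Longrightarrow> 0 \<le> q' \<Longrightarrow> q' \<le> 1 \<Longrightarrow> 0 \<le> kap q q' x y z"
  by (simp add: kap_def bern_nonneg)

lemma sum_kap: "(\<Sum>z<2. kap q q' x y z) = 1"
  by (simp add: kap_def sum_bern)

lemma chain_3: "chain q q' f 3 s = f (s 1) (s 2) (s 3)"
  by (simp add: chain_def)

lemma chain_Suc:
  assumes "3 \<le> N"
  shows "chain q q' f (Suc N) s =
    chain q q' f N s * (if even N then kap q' q else kap q q') (s (N - 1)) (s N) (s (Suc N))"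
proof -
  have "{4..Suc N} = insert (Suc N) {4..N}" using assms by auto
  moreover have "Suc N - 2 = N - 1" by simp
  ultimately show ?thesis by (simp add: chain_def)
qed

lemma chain_two_more:
  assumes "1 \<le> k"
  shows "chain q q' f (2 * Suc k + 1) t = chain q q' f (2 * k + 1) t *
    kap q q' (t (2 * k)) (t (2 * k + 1)) (t (2 * k + 2)) * kap q' q (t (2 * k + 1)) (t (2 * k + 2)) (t (2 * k + 3))"
proof -
  have e: "2 * Suc k + 1 = Suc (Suc (Suc (2 * k)))" "2 * k + 3 = Suc (Suc (Suc (2 * k)))"
    "2 * k + 2 = Suc (Suc (2 * k))" "2 * k + 1 = Suc (2 * k)" by simp_all
  show ?thesis
    unfolding e using chain_Suc[of "Suc (Suc (2 * k))" q q' f t] chain_Suc[of "Suc (2 * k)" q q' f t] assms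
    by simp
qed

lemma chain_cong:
  assumes "3 \<le> N" "\<And>j. 1 \<le> j \<Longrightarrow> j \<le> N \<Longrightarrow> s j = t j"
  shows "chain q q' f N s = chain q q' f N t"
  using assms(1) unfolding chain_def by (intro arg_cong2[where f = "(*)"] prod.cong) (auto simp: assms(2))

lemma chain_nonneg:
  assumes "\<And>x y z. 0 \<le> f x y z" "0 \<le> q" "q \<le> 1" "0 \<le> q'" "q' \<le> 1"
  shows "0 \<le> chain q q' f N s"
  unfolding chain_def using assms by (intro mult_nonneg_nonneg prod_nonneg) (auto intro: kap_nonneg)

text \<open>The local identity behind stationarity: \<open>x\<close> and \<open>p\<close> are
  updated together, and the roles of \<open>u\<close> and \<open>v\<close> are interchanged. The
  outer site \<open>a\<close> drops out because \<open>kap\<close> ignores its first site for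
  \<open>y = 0\<close>, while for \<open>y = 1\<close> the update is the flip
  \<open>chi a x 1 = 1 - x\<close>.\<close>

lemma kap_exchange:
  assumes "x < 2" "y < 2" "p < 2" "q < 2" "a < 2"
  shows "kap u v (chi a x y) y (chi y p q) * kap v u y (chi y p q) q = kap v u x y p * kap u v y p q"
  by (rule less_2_cases[OF assms(1)]; rule less_2_cases[OF assms(2)]; rule less_2_cases[OF assms(3)];
      rule less_2_cases[OF assms(4)]; rule less_2_cases[OF assms(5)];
      simp add: chi_def kap_def bern_def algebra_simps)

lemma sum_pair_weight_kap:
  assumes "y < 2" "b < 2"
  shows "(\<Sum>x<2. pair_weight q' q x y * kap q q' x y b) = pair_weight q q' y b"
  by (rule less_2_cases[OF assms(1)]; rule less_2_cases[OF assms(2)];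
      simp add: sum_lessThan_2 pair_weight_def kap_def bern_def algebra_simps)

lemma sum_site_Suc:
  assumes F: "local_fun (Suc N) F"
  shows "(\<Sum>i<2 ^ Suc N. F (site (Suc N) i)) = (\<Sum>i<2 ^ N. \<Sum>b<2. F ((site N i)(Suc N := b)))"
proof -
  have "(\<Sum>i<2 ^ Suc N. F (site (Suc N) i)) = (\<Sum>i<2 ^ N. \<Sum>b<2. F (site (Suc N) (i * 2 + b)))"
    using sum_lessThan_mult[of "\<lambda>i. F (site (Suc N) i)" "2 ^ N" 2] by (simp add: mult.commute)
  also have "\<dots> = (\<Sum>i<2 ^ N. \<Sum>b<2. F ((site N i)(Suc N := b)))"
  proof (intro sum.cong refl)
    fix i b :: nat assume "b \<in> {..<2}"
    then have b: "b < 2" by simp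
    show "F (site (Suc N) (i * 2 + b)) = F ((site N i)(Suc N := b))"
    proof (rule local_funD[OF F])
      fix j assume j: "1 \<le> j" "j \<le> Suc N"
      show "site (Suc N) (i * 2 + b) j = ((site N i)(Suc N := b)) j"
        using site_Suc[of j N b i] site_Suc_last[of b N i] b j by (cases "j = Suc N") (simp_all add: mult.commute)
    qed
  qed
  finally show ?thesis .
qed

lemma sum_chain_Suc:
  assumes N: "3 \<le> N" and g: "local_fun (Suc N) g"
  shows "(\<Sum>i<2 ^ Suc N. g (site (Suc N) i) * chain q q' f (Suc N) (site (Suc N) i)) =
    (\<Sum>i<2 ^ N. (\<Sum>b<2. g ((site N i)(Suc N := b)) *
      (if even N then kap q' q else kap q q') (site N i (N - 1)) (site N i N) b) * chain q q' f N (site N i))"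
proof -
  have loc: "local_fun (Suc N) (\<lambda>s. g s * chain q q' f (Suc N) s)"
    unfolding local_fun_def
  proof (intro allI impI)
    fix s t assume "eq_upto (Suc N) s t"
    then have e: "s j = t j" if "1 \<le> j" "j \<le> Suc N" for j using that by (simp add: eq_upto_def)
    have "g s = g t" by (rule local_funD[OF g e])
    moreover have "chain q q' f (Suc N) s = chain q q' f (Suc N) t"
      by (rule chain_cong) (use N e in auto)
    ultimately show "g s * chain q q' f (Suc N) s = g t * chain q q' f (Suc N) t" by simp
  qed
  have step: "chain q q' f (Suc N) ((site N i)(Suc N := b)) =
      chain q q' f N (site N i) * (if even N then kap q' q else kap q q') (site N i (N - 1)) (site N i N) b" for i b
  proof -
    have "chain q q' f N ((site N i)(Suc N := b)) = chain q q' f N (site N i)"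
      by (rule chain_cong[OF N]) simp
    moreover have "N - 1 \<noteq> Suc N" by simp
    ultimately show ?thesis unfolding chain_Suc[OF N] by simp
  qed
  show ?thesis
    unfolding sum_site_Suc[OF loc] step by (simp add: sum_distrib_right sum_distrib_left mult_ac)
qed

text \<open>Each factor \<open>kap\<close> is a probability in its last argument, so the sites
  beyond N are summed out one by one from the right.\<close>

lemma sum_chain_drop:
  assumes "3 \<le> N" and g: "local_fun N g" and "N \<le> M"
  shows "(\<Sum>i<2 ^ M. g (site M i) * chain q q' f M (site M i)) = (\<Sum>i<2 ^ N. g (site N i) * chain q q' f N (site N i))"
  using assms(3)
proof (induction rule: dec_induct)
  case (step M)
  have "local_fun (Suc M) g"
    using g step(1) by (auto simp: local_fun_def eq_upto_def)
  moreover have "g ((site M i)(Suc M := b)) = g (site M i)" for i b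
    by (rule local_funD[OF g]) (use step(1) in auto)
  ultimately show ?case
    using sum_chain_Suc[of M g q q' f] assms(1) step
    by (simp add: sum_kap flip: sum_distrib_left)
qed simp

lemma sum_site_3: "(\<Sum>i<2 ^ 3. G (site 3 i 1) (site 3 i 2) (site 3 i 3)) = (\<Sum>x<2. \<Sum>y<2. \<Sum>z<2. (G x y z :: real))"
  by (simp add: sum_lessThan_8 sum_lessThan_2 site_def add_ac flip: numeral_2_eq_2)

text \<open>Appending a site and summing out the oldest one turns \<open>pair_weight q' q\<close>
  into \<open>pair_weight q q'\<close> and back. The initial law matters only through its marginal
  on the sites 2 and 3.\<close>

lemma sum_chain_last_two:
  assumes f: "\<And>y z. y < 2 \<Longrightarrow> z < 2 \<Longrightarrow> (\<Sum>x<2. f x y z) = pair_weight q' q y z" and N: "3 \<le> N"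
  shows "(\<Sum>i<2 ^ N. g (site N i (N - 1)) (site N i N) * chain q q' f N (site N i)) =
    (\<Sum>x<2. \<Sum>y<2. g x y * (if even N then pair_weight q q' else pair_weight q' q) x y)"
  using N
proof (induction N arbitrary: g rule: dec_induct)
  case base
  have "(\<Sum>i<2 ^ 3. g (site 3 i (3 - 1)) (site 3 i 3) * chain q q' f 3 (site 3 i)) =
    (\<Sum>i<2 ^ 3. g (site 3 i 2) (site 3 i 3) * f (site 3 i 1) (site 3 i 2) (site 3 i 3))"
    by (simp add: chain_3)
  also have "\<dots> = (\<Sum>x<2. \<Sum>y<2. \<Sum>z<2. g y z * f x y z)"
    by (rule sum_site_3)
  also have "\<dots> = (\<Sum>y<2. \<Sum>z<2. g y z * (\<Sum>x<2. f x y z))"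
    by (simp add: sum_lessThan_2 algebra_simps)
  also have "\<dots> = (\<Sum>y<2. \<Sum>z<2. g y z * pair_weight q' q y z)"
    by (intro sum.cong refl) (simp add: f)
  finally show ?case by simp
next
  case (step N)
  let ?K = "if even N then kap q' q else kap q q'"
  let ?P = "if even N then pair_weight q q' else pair_weight q' q"
  let ?P' = "if even N then pair_weight q' q else pair_weight q q'"
  have loc: "local_fun (Suc N) (\<lambda>s. g (s N) (s (Suc N)))"
    using step(1) by (auto simp: local_fun_def eq_upto_def)
  have "(\<Sum>i<2 ^ Suc N. g (site (Suc N) i N) (site (Suc N) i (Suc N)) * chain q q' f (Suc N) (site (Suc N) i)) =
     (\<Sum>i<2 ^ N. (\<Sum>b<2. g (site N i N) b * ?K (site N i (N - 1)) (site N i N) b) * chain q q' f N (site N i))"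
    unfolding sum_chain_Suc[OF step(1) loc] by simp
  also have "\<dots> = (\<Sum>x<2. \<Sum>y<2. (\<Sum>b<2. g y b * ?K x y b) * ?P x y)"
    by (rule step.IH)
  also have "\<dots> = (\<Sum>y<2. \<Sum>b<2. g y b * (\<Sum>x<2. ?P x y * ?K x y b))"
    by (simp add: sum_lessThan_2 algebra_simps)
  also have "\<dots> = (\<Sum>y<2. \<Sum>b<2. g y b * ?P' y b)"
    by (intro sum.cong refl) (simp add: sum_pair_weight_kap)
  finally show ?case by simp
qed

section \<open>The parameters and the boundary laws\<close>

locale rule54_chain =
  fixes \<alpha> \<beta> \<gamma> \<delta> :: real
  assumes \<alpha>: "0 < \<alpha>" "\<alpha> < 1" and \<beta>: "0 < \<beta>" "\<beta> < 1" and \<gamma>: "0 < \<gamma>" "\<gamma> < 1" and \<delta>: "0 < \<delta>" "\<delta> < 1"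
begin

definition lam :: real where "lam = \<alpha> - \<beta>"
definition mu :: real where "mu = \<gamma> - \<delta>"
definition u :: real where "u = (2 + lam) / (4 - lam * mu)"
definition v :: real where "v = (2 + mu) / (4 - lam * mu)"

lemma lam_mu: "- 1 < lam" "lam < 1" "- 1 < mu" "mu < 1"
  using \<alpha> \<beta> \<gamma> \<delta> by (auto simp: lam_def mu_def)

text \<open>The first bound makes the common denominator of \<open>u\<close> and \<open>v\<close>
  positive; the other two are \<open>u < 1\<close> and \<open>v < 1\<close> with denominators
  cleared.\<close>

lemma lam_mu_bounds: "lam * mu < 1" "lam * (1 + mu) < 2" "mu * (1 + lam) < 2"
proof -
  have "\<bar>lam * mu\<bar> < 1 * 1" unfolding abs_mult
    by (rule mult_strict_mono) (use lam_mu in auto)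
  then show 1: "lam * mu < 1" by simp
  show "lam * (1 + mu) < 2" "mu * (1 + lam) < 2"
    using 1 lam_mu by (simp_all add: algebra_simps)
qed

lemma u_bounds: "0 < u" "u < 1"
  using lam_mu lam_mu_bounds by (simp_all add: u_def field_simps)

lemma v_bounds: "0 < v" "v < 1"
  using lam_mu lam_mu_bounds by (simp_all add: v_def field_simps)

lemma lam_eq: "v * lam = 2 * u - 1"
  using lam_mu_bounds by (simp add: u_def v_def field_simps)

lemma mu_eq: "u * mu = 2 * v - 1"
  using lam_mu_bounds by (simp add: u_def v_def field_simps)

text \<open>The laws of the boundary sites are determined by the exchange relation below and by
  \<open>right_even_step\<close>, respectively \<open>left_odd_step\<close>.\<close>

definition r0 :: real where "r0 = (1 - u) / (2 * v)"
definition r1 :: real where "r1 = (1 - u) / (2 * (1 - v))"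
definition rr :: real where "rr = 1 - \<gamma> * (1 - r0) - (1 - \<delta>) * r0"

definition right_even :: "nat \<Rightarrow> nat \<Rightarrow> nat \<Rightarrow> real" where
  "right_even x y = bern (if y = 0 then (if x = 0 then 1 - r1 else rr)
     else (if x = 0 then r0 else 1 / 2))"

definition right_odd :: "nat \<Rightarrow> nat \<Rightarrow> nat \<Rightarrow> real" where
  "right_odd x y = bern (if y = 0 then 1 / 2 else if x = 0 then (1 - mu) / 2 else rr)"

text \<open>The branches with \<open>y = 1\<close> are forced by \<open>left_odd_step\<close>. A
  uniform site 1 next to a one is sent to a one with probability (1 - lam)/2, which gives the case
  \<open>z = 0\<close>. The case \<open>z = 1\<close> is the image of the weights v(1 + lam)/2 and
  (1 - v)/2 that \<open>left_odd t 1 0\<close> has at t = 0, 1.\<close>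

definition left_even :: "nat \<Rightarrow> nat \<Rightarrow> nat \<Rightarrow> real" where
  "left_even x y z = (if y = 0 then bern v z / 2
     else if z = 0 then v * bern ((1 - lam) / 2) x
     else boundary_weight \<alpha> \<beta> 1 x 0 * (v * (1 + lam) / 2) + boundary_weight \<alpha> \<beta> 1 x 1 * ((1 - v) / 2))"

definition left_odd :: "nat \<Rightarrow> nat \<Rightarrow> nat \<Rightarrow> real" where
  "left_odd x y z = left_even x (chi x y z) z"

text \<open>These are the cases \<open>y = 0\<close> of the exchange relation at the right end, one
  for each pair of values \<open>p\<close>, \<open>q\<close>. The first and the last determine
  \<open>r1\<close> and \<open>r0\<close>; the other two are then equivalent to
  \<open>mu_eq\<close>.\<close>

lemma r0_r1_eq:
  shows "(1 - u) * (1 / 2) = (1 - v) * r1" "u * ((1 - mu) / 2) = (1 - v) * (1 - r1)"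
    and "u * (1 - (1 - mu) / 2) = v * (1 - r0)" "(1 - u) * (1 / 2) = v * r0"
proof -
  have "(2 * v) * r0 = 1 - u" "(2 * (1 - v)) * r1 = 1 - u"
    using v_bounds unfolding r0_def r1_def by (simp_all only: nonzero_mult_div_cancel_left times_divide_eq_right) simp_all
  then have r: "2 * (v * r0) = 1 - u" "2 * (r1 - v * r1) = 1 - u"
    by (simp_all add: algebra_simps)
  show "(1 - u) * (1 / 2) = (1 - v) * r1" "u * ((1 - mu) / 2) = (1 - v) * (1 - r1)"
    "u * (1 - (1 - mu) / 2) = v * (1 - r0)" "(1 - u) * (1 / 2) = v * r0"
    using r mu_eq by (simp_all add: algebra_simps diff_divide_distrib add_divide_distrib)
qed

lemma r_bounds: "0 \<le> r0" "r0 \<le> 1" "0 \<le> r1" "r1 \<le> 1" "0 \<le> rr" "rr \<le> 1"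
proof -
  \<comment> \<open>By \<open>mu_eq\<close> these two inequalities say exactly that
    \<open>1 - u\<close> is at most \<open>2 * v\<close> and at most \<open>2 * (1 - v)\<close>,
    that is, \<open>r0\<close> and \<open>r1\<close> do not exceed one.\<close>
  have "0 \<le> u * (1 + mu)" "0 \<le> u * (1 - mu)"
    using u_bounds lam_mu by auto
  then have *: "1 - u \<le> 2 * v" "1 - u \<le> 2 * (1 - v)"
    using mu_eq by (simp_all add: algebra_simps)
  show r: "0 \<le> r0" "r0 \<le> 1" "0 \<le> r1" "r1 \<le> 1"
    using * u_bounds v_bounds by (simp_all add: r0_def r1_def)
  have "rr = (1 - \<gamma>) * (1 - r0) + \<delta> * r0" "1 - rr = \<gamma> * (1 - r0) + (1 - \<delta>) * r0"
    by (simp_all add: rr_def algebra_simps)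
  moreover have "0 \<le> (1 - \<gamma>) * (1 - r0) + \<delta> * r0" "0 \<le> \<gamma> * (1 - r0) + (1 - \<delta>) * r0"
    using r \<gamma> \<delta> by (intro add_nonneg_nonneg mult_nonneg_nonneg; linarith)+
  ultimately show "0 \<le> rr" "rr \<le> 1" by linarith+
qed

lemma right_even_nonneg: "0 \<le> right_even x y z"
  unfolding right_even_def by (intro bern_nonneg) (use r_bounds in auto)

lemma left_even_nonneg: "0 \<le> left_even x y z"
  using lam_mu v_bounds less_imp_le[OF boundary_weight_pos[OF \<alpha> \<beta>]]
  by (auto simp: left_even_def intro!: mult_nonneg_nonneg add_nonneg_nonneg bern_nonneg)

text \<open>For \<open>y = 0\<close> the boundary weight is constant and \<open>right_even\<close>
  sums to one; for \<open>y = 1\<close> the neighbour is flipped. Either way nothing depends on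
  \<open>a\<close>.\<close>

lemma right_even_step:
  assumes "a < 2" "x < 2" "y < 2" "z < 2"
  shows "(\<Sum>t<2. boundary_weight \<gamma> \<delta> y z t * right_even (chi a x y) y t) = right_odd x y z"
  by (rule less_2_cases[OF assms(1)]; rule less_2_cases[OF assms(2)]; rule less_2_cases[OF assms(3)]; rule less_2_cases[OF assms(4)];
      simp add: sum_lessThan_2 boundary_weight_def right_even_def right_odd_def rr_def bern_def chi_def mu_def algebra_simps add_divide_distrib diff_divide_distrib)

text \<open>For \<open>y = 1\<close> this is how \<open>left_even\<close> was chosen. For
  \<open>y = 0\<close> site 1 becomes uniform, and the mass left for each \<open>z\<close> is
  correct by \<open>lam_eq\<close>.\<close>

lemma left_odd_step:
  assumes "x < 2" "y < 2" "z < 2"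
  shows "(\<Sum>t<2. boundary_weight \<alpha> \<beta> y x t * left_odd t y z) =
    (if y = 0 then bern u z / 2 else left_even x 1 (1 - z))"
  by (rule less_2_cases[OF assms(1)]; rule less_2_cases[OF assms(2)]; rule less_2_cases[OF assms(3)];
      use lam_eq in \<open>simp add: sum_lessThan_2 boundary_weight_def left_odd_def left_even_def bern_def chi_def lam_def algebra_simps add_divide_distrib diff_divide_distrib\<close>)

lemma sum_left_even:
  assumes "y < 2" "z < 2"
  shows "(\<Sum>x<2. left_even x y z) = pair_weight v u y z"
  by (rule less_2_cases[OF assms(1)]; rule less_2_cases[OF assms(2)];
      use lam_eq in \<open>simp add: sum_lessThan_2 boundary_weight_def left_even_def bern_def pair_weight_def algebra_simps add_divide_distrib diff_divide_distrib\<close>)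

text \<open>Relation that moves the odd half step one pair of sites to the right: the factor
  for the next site is \<open>T'\<close> before and \<open>T\<close> after the update of \<open>p\<close> between \<open>y\<close> and \<open>q\<close>.\<close>

definition exchangeable :: "(nat \<Rightarrow> nat \<Rightarrow> nat \<Rightarrow> real) \<Rightarrow> (nat \<Rightarrow> nat \<Rightarrow> nat \<Rightarrow> real) \<Rightarrow> bool" where
  "exchangeable T' T \<longleftrightarrow> (\<forall>a x y p q. a < 2 \<longrightarrow> x < 2 \<longrightarrow> y < 2 \<longrightarrow> p < 2 \<longrightarrow> q < 2 \<longrightarrow>
     kap u v (chi a x y) y (chi y p q) * T' y (chi y p q) q = kap v u x y p * T y p q) \<and>
     (\<forall>p q. p < 2 \<longrightarrow> q < 2 \<longrightarrow> T' 1 (1 - p) q = T 1 p q)"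

lemma exchangeableD:
  assumes "exchangeable T' T"
  shows "a < 2 \<Longrightarrow> x < 2 \<Longrightarrow> y < 2 \<Longrightarrow> p < 2 \<Longrightarrow> q < 2 \<Longrightarrow>
      kap u v (chi a x y) y (chi y p q) * T' y (chi y p q) q = kap v u x y p * T y p q"
    and "p < 2 \<Longrightarrow> q < 2 \<Longrightarrow> T' 1 (1 - p) q = T 1 p q"
  using assms by (simp_all add: exchangeable_def)

lemma exchangeable_kap: "exchangeable (kap v u) (kap u v)"
proof -
  have "kap v u 1 (1 - p) q = kap u v 1 p q" if "p < 2" "q < 2" for p q
    by (rule less_2_cases[OF that(1)]; rule less_2_cases[OF that(2)]; simp add: kap_def bern_def)
  then show ?thesis using kap_exchange by (auto simp: exchangeable_def)
qed

lemma exchangeable_right: "exchangeable right_odd right_even"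
proof -
  have "right_odd 1 (1 - p) q = right_even 1 p q" if "p < 2" "q < 2" for p q
    by (rule less_2_cases[OF that(1)]; rule less_2_cases[OF that(2)]; simp add: right_odd_def right_even_def bern_def)
  moreover have "kap u v (chi a x y) y (chi y p q) * right_odd y (chi y p q) q = kap v u x y p * right_even y p q"
    if "a < 2" "x < 2" "y < 2" "p < 2" "q < 2" for a x y p q
    by (rule less_2_cases[OF that(1)]; rule less_2_cases[OF that(2)]; rule less_2_cases[OF that(3)];
        rule less_2_cases[OF that(4)]; rule less_2_cases[OF that(5)];
        use r0_r1_eq in \<open>simp add: kap_def right_odd_def right_even_def bern_def chi_def\<close>)
  ultimately show ?thesis by (simp add: exchangeable_def)
qed

section \<open>Invariance of the chains under the half steps\<close>

text \<open>The last updated site 2k has both neighbours inside the prefix and site 2k + 1 stays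
  fixed, so the claim closes under adding two sites by \<open>kap_exchange\<close>, without a
  correction factor.\<close>

lemma even_chain:
  assumes s: "bits n s" and n: "n = 2 * m" and k: "1 \<le> k" "k < m"
  shows "chain u v left_even (2 * k + 1) (half_step n 0 s) = chain v u left_odd (2 * k + 1) s"
  using k
proof (induction k rule: dec_induct)
  case base
  have h: "half_step n 0 s 1 = s 1" "half_step n 0 s 2 = chi (s 1) (s 2) (s 3)" "half_step n 0 s 3 = s 3"
    using base n by (simp_all add: half_step_def)
  have three: "2 * 1 + 1 = (3::nat)" by simp
  show ?case unfolding three chain_3 h left_odd_def by (rule refl)
next
  case (step k)
  let ?h = "half_step n 0 s"
  have b: "s j < 2" if "1 \<le> j" "j \<le> n" for j using bitsD[OF s that] .
  have h: "?h (2 * k) = chi (s (2 * k - 1)) (s (2 * k)) (s (2 * k + 1))" "?h (2 * k + 1) = s (2 * k + 1)"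
    "?h (2 * k + 2) = chi (s (2 * k + 1)) (s (2 * k + 2)) (s (2 * k + 3))" "?h (2 * k + 3) = s (2 * k + 3)"
    using step n by (simp_all add: half_step_def numeral_3_eq_3)
  note chain = chain_two_more[OF step(1)]
  show ?case
    unfolding chain h using step.IH kap_exchange[of "s (2 * k)" "s (2 * k + 1)" "s (2 * k + 2)" "s (2 * k + 3)" "s (2 * k - 1)" u v]
      b step n by (simp add: mult.assoc)
qed

text \<open>The update of the last site 2k + 1 reads site 2k + 2, so the prefix alone satisfies no
  identity and the factor \<open>T'\<close> or \<open>T\<close> of the next site is included. It is
  generalized in the induction: inside the chain it is \<open>kap\<close>, at the end it is the
  right boundary law.\<close>

lemma odd_chain:
  assumes s: "bits n s" and n: "n = 2 * m" and k: "1 \<le> k" "k < m" and T: "exchangeable T' T"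
  shows "(\<Sum>t<2. boundary_weight \<alpha> \<beta> (s 2) (s 1) t * chain v u left_odd (2 * k + 1) ((half_step n 1 s)(1 := t))) *
      T' (s (2 * k)) (half_step n 1 s (2 * k + 1)) (s (2 * k + 2)) =
    chain u v left_even (2 * k + 1) s * T (s (2 * k)) (s (2 * k + 1)) (s (2 * k + 2))"
  using k T
proof (induction k arbitrary: T T' rule: dec_induct)
  case base
  have b: "s 1 < 2" "s 2 < 2" "s 3 < 2" "s 4 < 2" using base(1) n by (auto intro!: bitsD[OF s])
  have h: "half_step n 1 s 1 = s 1" "half_step n 1 s 2 = s 2" "half_step n 1 s 3 = chi (s 2) (s 3) (s 4)"
    using base n by (simp_all add: half_step_def)
  have three: "2 * 1 = (2::nat)" "2 + 1 = (3::nat)" "2 + 2 = (4::nat)" by simp_all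
  have c: "chain v u left_odd 3 ((half_step n 1 s)(1 := t)) = left_odd t (s 2) (chi (s 2) (s 3) (s 4))" for t
    using h(2,3) by (simp add: chain_3)
  have "(\<Sum>t<2. boundary_weight \<alpha> \<beta> (s 2) (s 1) t * chain v u left_odd 3 ((half_step n 1 s)(1 := t))) =
    (if s 2 = 0 then bern u (chi (s 2) (s 3) (s 4)) / 2 else left_even (s 1) 1 (1 - chi (s 2) (s 3) (s 4)))"
    unfolding c by (rule left_odd_step[OF b(1,2) chi_less_2])
  also have "\<dots> * T' (s 2) (chi (s 2) (s 3) (s 4)) (s 4) = left_even (s 1) (s 2) (s 3) * T (s 2) (s 3) (s 4)"
    using b(2)
  proof (rule less_2_cases)
    assume 0: "s 2 = 0"
    \<comment> \<open>The zeros for \<open>a\<close> and \<open>x\<close> are placeholders: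
      \<open>kap\<close> does not depend on its first site when the second is zero.\<close>
    have "kap u v (chi 0 0 0) 0 (chi 0 (s 3) (s 4)) * T' 0 (chi 0 (s 3) (s 4)) (s 4) = kap v u 0 0 (s 3) * T 0 (s 3) (s 4)"
      by (rule exchangeableD(1)[OF base(2)]) (use b in auto)
    then show ?thesis using 0 by (simp add: kap_def left_even_def)
  next
    assume 1: "s 2 = 1"
    \<comment> \<open>Next to a one, site 3 is flipped, and \<open>left_odd_step\<close> supplies
      \<open>left_even\<close> with this flip undone. The second clause of
      \<open>exchangeable\<close> says that \<open>T'\<close> and \<open>T\<close> match under the
      same flip.\<close>
    have "chi 1 (s 3) (s 4) = 1 - s 3"
      using b(3,4) by (auto elim!: less_2_cases simp: chi_def)
    moreover have "T' 1 (1 - s 3) (s 4) = T 1 (s 3) (s 4)" using exchangeableD(2)[OF base(2)] b by blast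
    moreover have "1 - (1 - s 3) = s 3" using b(3) by simp
    ultimately show ?thesis using 1 by simp
  qed
  finally show ?case unfolding three h chain_3 .
next
  case (step k)
  let ?h = "half_step n 1 s"
  let ?w = "\<lambda>t. boundary_weight \<alpha> \<beta> (s 2) (s 1) t"
  have b: "s j < 2" if "1 \<le> j" "j \<le> n" for j using bitsD[OF s that] .
  have h: "?h (2 * k) = s (2 * k)" "?h (2 * k + 1) = chi (s (2 * k)) (s (2 * k + 1)) (s (2 * k + 2))"
    "?h (2 * k + 2) = s (2 * k + 2)" "?h (2 * k + 3) = chi (s (2 * k + 2)) (s (2 * k + 3)) (s (2 * k + 4))"
  proof -
    have par: "(2 * k) mod 2 \<noteq> 1" "(2 * k + 1) mod 2 = 1" "(2 * k + 2) mod 2 \<noteq> 1" "(2 * k + 3) mod 2 = 1"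
      by presburger+
    have idx: "2 * k + 1 - 1 = 2 * k" "2 * k + 1 + 1 = 2 * k + 2" "2 * k + 3 - 1 = 2 * k + 2" "2 * k + 3 + 1 = 2 * k + 4"
      by simp_all
    have bd: "1 < 2 * k + 1" "2 * k + 1 < n" "1 < 2 * k + 3" "2 * k + 3 < n"
      using step(1) step.prems(1) n by simp_all
    show "?h (2 * k) = s (2 * k)" "?h (2 * k + 2) = s (2 * k + 2)"
      using par unfolding half_step_def by (simp_all only: simp_thms if_False)
    show "?h (2 * k + 1) = chi (s (2 * k)) (s (2 * k + 1)) (s (2 * k + 2))"
      "?h (2 * k + 3) = chi (s (2 * k + 2)) (s (2 * k + 3)) (s (2 * k + 4))"
      using par bd unfolding half_step_def idx by (simp_all only: idx simp_thms if_True)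
  qed
  note chain = chain_two_more[OF step(1)]
  have k0: "2 * k \<noteq> 1" "2 * k + 1 \<noteq> 1" "2 * k + 2 \<noteq> 1" "2 * k + 3 \<noteq> 1" using step(1) by auto
  let ?S = "\<Sum>t<2. ?w t * chain v u left_odd (2 * k + 1) (?h(1 := t))"
  have "(\<Sum>t<2. ?w t * chain v u left_odd (2 * Suc k + 1) (?h(1 := t))) =
     ?S * kap v u (s (2 * k)) (?h (2 * k + 1)) (s (2 * k + 2)) *
     kap u v (?h (2 * k + 1)) (s (2 * k + 2)) (?h (2 * k + 3))"
    unfolding chain fun_upd_other[OF k0(1)] fun_upd_other[OF k0(2)] fun_upd_other[OF k0(3)] fun_upd_other[OF k0(4)] h(1,3)
    by (simp only: sum_distrib_right mult.assoc)
  also have "?S * kap v u (s (2 * k)) (?h (2 * k + 1)) (s (2 * k + 2)) =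
      chain u v left_even (2 * k + 1) s * kap u v (s (2 * k)) (s (2 * k + 1)) (s (2 * k + 2))"
    by (rule step.IH[OF _ exchangeable_kap]) (use step in simp)
  finally have *: "(\<Sum>t<2. ?w t * chain v u left_odd (2 * Suc k + 1) (?h(1 := t))) =
      chain u v left_even (2 * k + 1) s * kap u v (s (2 * k)) (s (2 * k + 1)) (s (2 * k + 2)) *
      kap u v (?h (2 * k + 1)) (s (2 * k + 2)) (?h (2 * k + 3))" .
  have ex: "kap u v (?h (2 * k + 1)) (s (2 * k + 2)) (?h (2 * k + 3)) * T' (s (2 * k + 2)) (?h (2 * k + 3)) (s (2 * k + 4)) =
      kap v u (s (2 * k + 1)) (s (2 * k + 2)) (s (2 * k + 3)) * T (s (2 * k + 2)) (s (2 * k + 3)) (s (2 * k + 4))"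
    unfolding h by (rule exchangeableD(1)[OF step.prems(2)]) (use b step.prems(1) step(1) n in auto)
  have idx: "2 * Suc k = 2 * k + 2" "2 * k + 2 + 1 = 2 * k + 3" "2 * k + 2 + 2 = 2 * k + 4" by simp_all
  have chain': "chain u v left_even (2 * k + 3) s = chain u v left_even (2 * k + 1) s *
     kap u v (s (2 * k)) (s (2 * k + 1)) (s (2 * k + 2)) * kap v u (s (2 * k + 1)) (s (2 * k + 2)) (s (2 * k + 3))"
    using chain[of u v left_even s] unfolding idx .
  show ?case
    unfolding * using ex unfolding idx chain' by (simp add: mult.assoc)
qed

section \<open>The stationary weights and their marginals\<close>

text \<open>The steady state itself, that is, the weights before the even half step;
  \<open>weight_odd\<close> describes the state between the half steps. The norm
  \<open>1 + u + v\<close> is the total mass of a pair weight.\<close>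

definition weight_even :: "nat \<Rightarrow> (nat \<Rightarrow> nat) \<Rightarrow> real" where
  "weight_even n s = chain u v left_even (n - 1) s * right_even (s (n - 2)) (s (n - 1)) (s n) / (1 + u + v)"

definition weight_odd :: "nat \<Rightarrow> (nat \<Rightarrow> nat) \<Rightarrow> real" where
  "weight_odd n s = chain v u left_odd (n - 1) s * right_odd (s (n - 2)) (s (n - 1)) (s n) / (1 + u + v)"

lemma local_fun_weight:
  assumes "4 \<le> n"
  shows "local_fun n (weight_even n)" "local_fun n (weight_odd n)"
proof -
  have "weight_even n s = weight_even n t \<and> weight_odd n s = weight_odd n t" if e: "eq_upto n s t" for s t
  proof -
    have e: "s j = t j" if "1 \<le> j" "j \<le> n" for j using e that by (simp add: eq_upto_def)
    have "chain q q' f (n - 1) s = chain q q' f (n - 1) t" for q q' f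
      by (rule chain_cong) (use assms e in auto)
    then show ?thesis using e[of "n - 2"] e[of "n - 1"] e[of n] assms
      by (simp add: weight_even_def weight_odd_def)
  qed
  then show "local_fun n (weight_even n)" "local_fun n (weight_odd n)" by (auto simp: local_fun_def)
qed

lemma weight_even_step:
  assumes n: "n = 2 * m" "2 \<le> m" and s: "bits n s"
  shows "(\<Sum>t<2. boundary_weight \<gamma> \<delta> (s (n - 1)) (s n) t * weight_even n ((half_step n 0 s)(n := t))) = weight_odd n s"
proof -
  let ?h = "half_step n 0 s"
  have b: "s j < 2" if "1 \<le> j" "j \<le> n" for j using bitsD[OF s that] .
  obtain k where k: "m = k + 1" "1 \<le> k" using n(2) by (metis add.commute le_Suc_ex nat_1_add_1 add.assoc le_add1)
  have n': "n - 1 = 2 * k + 1" "n - 2 = 2 * k" "n = 2 * k + 2" using n k by auto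
  have h: "?h (2 * k) = chi (s (2 * k - 1)) (s (2 * k)) (s (2 * k + 1))" "?h (2 * k + 1) = s (2 * k + 1)"
    using k n' by (simp_all add: half_step_def)
  have c: "chain u v left_even (2 * k + 1) (?h(n := t)) = chain v u left_odd (2 * k + 1) s" for t
    unfolding even_chain[OF s n(1), of k, symmetric, OF k(2) less_add_one[of k, folded k(1)]]
    by (rule chain_cong) (use k n' in auto)
  have "(\<Sum>t<2. boundary_weight \<gamma> \<delta> (s (n - 1)) (s n) t * weight_even n (?h(n := t))) =
     chain v u left_odd (2 * k + 1) s * (\<Sum>t<2. boundary_weight \<gamma> \<delta> (s (2 * k + 1)) (s n) t *
       right_even (chi (s (2 * k - 1)) (s (2 * k)) (s (2 * k + 1))) (s (2 * k + 1)) t) / (1 + u + v)"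
    unfolding weight_even_def n'(1,2) c using n'(3) h
    by (simp add: sum_distrib_left sum_divide_distrib mult_ac)
  also have "(\<Sum>t<2. boundary_weight \<gamma> \<delta> (s (2 * k + 1)) (s n) t *
       right_even (chi (s (2 * k - 1)) (s (2 * k)) (s (2 * k + 1))) (s (2 * k + 1)) t) =
     right_odd (s (2 * k)) (s (2 * k + 1)) (s n)"
    by (rule right_even_step) (use b n' k in auto)
  finally show ?thesis unfolding weight_odd_def n'(1,2) .
qed

lemma weight_odd_step:
  assumes n: "n = 2 * m" "2 \<le> m" and s: "bits n s"
  shows "(\<Sum>t<2. boundary_weight \<alpha> \<beta> (s 2) (s 1) t * weight_odd n ((half_step n 1 s)(1 := t))) = weight_even n s"
proof -
  let ?h = "half_step n 1 s"
  obtain k where k: "m = k + 1" "1 \<le> k" using n(2) by (metis add.commute le_Suc_ex nat_1_add_1 add.assoc le_add1)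
  have n': "n - 1 = 2 * k + 1" "n - 2 = 2 * k" "n = 2 * k + 2" using n k by auto
  have h: "(?h(1 := t)) (2 * k) = s (2 * k)" "(?h(1 := t)) (2 * k + 1) = ?h (2 * k + 1)" "(?h(1 := t)) n = s n" for t
    using k n' by (simp_all add: half_step_def)
  have "(\<Sum>t<2. boundary_weight \<alpha> \<beta> (s 2) (s 1) t * weight_odd n (?h(1 := t))) =
     (\<Sum>t<2. boundary_weight \<alpha> \<beta> (s 2) (s 1) t * chain v u left_odd (2 * k + 1) (?h(1 := t))) *
     right_odd (s (2 * k)) (?h (2 * k + 1)) (s (2 * k + 2)) / (1 + u + v)"
    unfolding weight_odd_def n'(1,2) h
    by (simp only: n'(3) sum_distrib_right sum_divide_distrib mult.assoc times_divide_eq_right)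
  also have "\<dots> = weight_even n s"
    using odd_chain[OF s n(1) k(2) _ exchangeable_right] k n' by (simp add: weight_even_def)
  finally show ?thesis .
qed

lemma U_mat_weight_even:
  assumes n: "n = 2 * m" "2 \<le> m"
  shows "U_mat n \<alpha> \<beta> \<gamma> \<delta> *\<^sub>v vecf n (weight_even n) = vecf n (weight_even n)"
proof -
  have l: "local_fun n (weight_even n)" "local_fun n (weight_odd n)"
    using local_fun_weight n by auto
  have "U_mat n \<alpha> \<beta> \<gamma> \<delta> *\<^sub>v vecf n (weight_even n) = U_odd n \<alpha> \<beta> *\<^sub>v (U_even n \<gamma> \<delta> *\<^sub>v vecf n (weight_even n))"
    unfolding U_mat_def
    by (rule assoc_mult_mat_vec[OF U_odd_vecf(1)[OF n l(1)] U_even_vecf(1)[OF n l(1)]]) simp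
  also have "U_even n \<gamma> \<delta> *\<^sub>v vecf n (weight_even n) = vecf n (weight_odd n)"
    unfolding U_even_vecf(2)[OF n l(1)] by (rule vecf_eqI) (rule weight_even_step[OF n])
  also have "U_odd n \<alpha> \<beta> *\<^sub>v vecf n (weight_odd n) = vecf n (weight_even n)"
    unfolding U_odd_vecf(2)[OF n l(2)] by (rule vecf_eqI) (rule weight_odd_step[OF n])
  finally show ?thesis .
qed

lemma sum_weight_even:
  assumes n: "4 \<le> n" and g: "local_fun n g"
  shows "(\<Sum>i<2 ^ n. g (site n i) * weight_even n (site n i)) =
    (\<Sum>i<2 ^ (n - 1). (\<Sum>b<2. g ((site (n - 1) i)(n := b)) * right_even (site (n - 1) i (n - 2)) (site (n - 1) i (n - 1)) b) *
       chain u v left_even (n - 1) (site (n - 1) i)) / (1 + u + v)"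
proof -
  define N where "N = n - 1"
  then have N: "n = Suc N" using n by simp
  have loc: "local_fun (Suc N) (\<lambda>s. g s * weight_even n s)"
    using g local_fun_weight(1)[OF n] N by (auto simp: local_fun_def)
  have c: "chain u v left_even N ((site N i)(Suc N := b)) = chain u v left_even N (site N i)" for i b
    by (rule chain_cong) (use n N in auto)
  have "N - 1 \<noteq> Suc N" by simp
  then show ?thesis
    unfolding N sum_site_Suc[OF loc[unfolded N]]
    using n N by (simp add: weight_even_def c sum_distrib_left sum_distrib_right sum_divide_distrib mult_ac)
qed

lemma sum_weight_even_drop:
  assumes N: "3 \<le> N" "N < n" and g: "local_fun N g"
  shows "(\<Sum>i<2 ^ n. g (site n i) * weight_even n (site n i)) =
    (\<Sum>i<2 ^ N. g (site N i) * chain u v left_even N (site N i)) / (1 + u + v)"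
proof -
  have "local_fun n g" using g N by (auto simp: local_fun_def eq_upto_def)
  moreover have "g ((site (n - 1) i)(n := b)) = g (site (n - 1) i)" for i b
    by (rule local_funD[OF g]) (use N in auto)
  moreover have "(\<Sum>b<2. right_even x y b) = 1" for x y by (simp add: right_even_def sum_bern)
  ultimately have "(\<Sum>i<2 ^ n. g (site n i) * weight_even n (site n i)) =
    (\<Sum>i<2 ^ (n - 1). g (site (n - 1) i) * chain u v left_even (n - 1) (site (n - 1) i)) / (1 + u + v)"
    using sum_weight_even[of n g] N by (simp flip: sum_distrib_left)
  also have "\<dots> = (\<Sum>i<2 ^ N. g (site N i) * chain u v left_even N (site N i)) / (1 + u + v)"
    using sum_chain_drop[OF N(1) g, of "n - 1" u v left_even] N by simp
  finally show ?thesis .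
qed

lemma sum_weight_even_pair:
  assumes N: "3 \<le> N" "N < n"
  shows "(\<Sum>i<2 ^ n. g (site n i (N - 1)) (site n i N) * weight_even n (site n i)) =
    (\<Sum>x<2. \<Sum>y<2. g x y * (if even N then pair_weight u v else pair_weight v u) x y) / (1 + u + v)"
proof -
  have "s (N - 1) = t (N - 1)" "s N = t N" if "eq_upto N s t" for s t
    using that N by (auto simp: eq_upto_def)
  then have "local_fun N (\<lambda>s. g (s (N - 1)) (s N))"
    unfolding local_fun_def by metis
  then show ?thesis
    using sum_weight_even_drop[OF N, of "\<lambda>s. g (s (N - 1)) (s N)"] sum_chain_last_two[OF sum_left_even N(1), of g] by simp
qed

lemma steady_state_weight_even:
  assumes n: "n = 2 * m" "2 \<le> m"
  shows "steady_state n \<alpha> \<beta> \<gamma> \<delta> (vecf n (weight_even n))"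
proof -
  have "0 \<le> weight_even n s" for s
    unfolding weight_even_def using u_bounds v_bounds
    by (intro divide_nonneg_pos mult_nonneg_nonneg chain_nonneg left_even_nonneg right_even_nonneg) auto
  moreover have "(\<Sum>i<2 ^ n. weight_even n (site n i)) = 1"
    using sum_weight_even_pair[of 3 n "\<lambda>x y. 1"] n u_bounds v_bounds
    by (simp add: sum_lessThan_2 pair_weight_def)
  ultimately show ?thesis
    using U_mat_weight_even[OF n] by (simp add: steady_state_def probability_vector_def)
qed

section \<open>Densities, currents and their closed forms\<close>

text \<open>In both pair weights a one at a given site has mass u + v, so the two sublattices have
  equal density. Site 2 is read as the first member of the pair (2, 3), because pair marginals start
  with that pair.\<close>

lemma density_bulk:
  assumes "4 \<le> n" "1 < j" "j < n"
  shows "density n (vecf n (weight_even n)) j = (u + v) / (1 + u + v)"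
proof (cases "j = 2")
  case True
  then show ?thesis
    using sum_weight_even_pair[of 3 n "\<lambda>x y. real x"] assms
    by (simp add: density_def sum_lessThan_2 pair_weight_def)
next
  case False
  then show ?thesis
    using sum_weight_even_pair[of j n "\<lambda>x y. real y"] assms
    by (simp add: density_def sum_lessThan_2 pair_weight_def add.commute)
qed

lemma density_first:
  assumes "4 \<le> n"
  shows "density n (vecf n (weight_even n)) 1 =
    (1 + v * (1 - lam) + (1 - \<alpha>) * (v * (1 + lam)) + \<beta> * (1 - v)) / (2 * (1 + u + v))"
proof -
  have "local_fun 3 (\<lambda>s. real (s 1))" by (simp add: local_fun_def eq_upto_def)
  then have "density n (vecf n (weight_even n)) 1 = (\<Sum>i<2 ^ 3. real (site 3 i 1) * chain u v left_even 3 (site 3 i)) / (1 + u + v)"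
    using sum_weight_even_drop[of 3 n "\<lambda>s. real (s 1)"] assms by (simp add: density_def)
  also have "\<dots> = (\<Sum>x<2. \<Sum>y<2. \<Sum>z<2. real x * left_even x y z) / (1 + u + v)"
    unfolding chain_3 using sum_site_3[of "\<lambda>x y z. real x * left_even x y z"] by simp
  also have "\<dots> = (1 + v * (1 - lam) + (1 - \<alpha>) * (v * (1 + lam)) + \<beta> * (1 - v)) / 2 / (1 + u + v)"
    by (simp add: sum_lessThan_2 left_even_def bern_def boundary_weight_def add_divide_distrib diff_divide_distrib algebra_simps)
  finally show ?thesis by simp
qed

lemma density_last:
  assumes n: "4 \<le> n" "even n"
  shows "density n (vecf n (weight_even n)) n =
    ((1 - v) * (1 - r1) + v * r0 + v * rr + u / 2) / (1 + u + v)"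
proof -
  have "local_fun n (\<lambda>s. real (s n))" using n by (simp add: local_fun_def eq_upto_def)
  then have "density n (vecf n (weight_even n)) n =
    (\<Sum>i<2 ^ (n - 1). right_even (site (n - 1) i (n - 1 - 1)) (site (n - 1) i (n - 1)) 1 *
       chain u v left_even (n - 1) (site (n - 1) i)) / (1 + u + v)"
    using sum_weight_even[OF n(1), of "\<lambda>s. real (s n)"] by (simp add: density_def sum_lessThan_2 numeral_2_eq_2)
  also have "\<dots> = (\<Sum>x<2. \<Sum>y<2. right_even x y 1 * pair_weight v u x y) / (1 + u + v)"
    using sum_chain_last_two[OF sum_left_even, of "n - 1" "\<lambda>x y. right_even x y 1"] n by simp
  finally show ?thesis
    by (simp add: sum_lessThan_2 right_even_def pair_weight_def bern_def algebra_simps)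
qed

text \<open>The pair ends at an odd site, so its weight is \<open>pair_weight v u\<close>, in which
  two ones have mass \<open>u\<close>. For left-movers the parity, and with it the mass, is
  interchanged.\<close>

lemma J_right_weight_even:
  assumes "1 \<le> k" "2 * k + 1 < n"
  shows "J_right n (vecf n (weight_even n)) k = u / (1 + u + v)"
  using sum_weight_even_pair[of "2 * k + 1" n "\<lambda>x y. real (x * y)"] assms
  by (simp add: J_right_def sum_lessThan_2 pair_weight_def)

lemma J_left_weight_even:
  assumes "1 \<le> k" "2 * k + 2 < n"
  shows "J_left n (vecf n (weight_even n)) k = v / (1 + u + v)"
  using sum_weight_even_pair[of "2 * k + 2" n "\<lambda>x y. real (x * y)"] assms
  by (simp add: J_left_def sum_lessThan_2 pair_weight_def)

lemma u_v_scaled: "u * (4 - lam * mu) = 2 + lam" "v * (4 - lam * mu) = 2 + mu"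
  using lam_mu_bounds by (simp_all add: u_def v_def)

text \<open>The origin of the common denominator: it is the mass \<open>1 + u + v\<close> with the
  denominator \<open>4 - lam * mu\<close> of \<open>u\<close> and \<open>v\<close> cleared.\<close>

lemma divide_norm:
  "x / (1 + u + v) = x * (4 - lam * mu) / (lam + mu + 8 - lam * mu)"
proof -
  have "(1 + u + v) * (4 - lam * mu) = lam + mu + 8 - lam * mu"
    using u_v_scaled by (simp add: distrib_right)
  then show ?thesis
    using lam_mu_bounds mult_divide_mult_cancel_right[of "4 - lam * mu" x "1 + u + v"] by simp
qed

lemma bulk_density_value: "(u + v) / (1 + u + v) = (lam + mu + 4) / (lam + mu + 8 - lam * mu)"
  using u_v_scaled by (simp add: divide_norm distrib_right)

lemma right_movers_value: "u / (1 + u + v) = (lam + 2) / (lam + mu + 8 - lam * mu)"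
  unfolding divide_norm u_v_scaled by (simp add: add.commute)

lemma left_movers_value: "v / (1 + u + v) = (mu + 2) / (lam + mu + 8 - lam * mu)"
  unfolding divide_norm u_v_scaled by (simp add: add.commute)

lemma density_first_value:
  assumes "4 \<le> n"
  shows "density n (vecf n (weight_even n)) 1 =
    (2 * (1 - \<alpha>) * (lam * mu + lam + mu) + (lam - 2) * (lam * mu - 4)) / (2 * (lam + mu + 8 - lam * mu))"
proof -
  let ?E = "1 + v * (1 - lam) + (1 - \<alpha>) * (v * (1 + lam)) + \<beta> * (1 - v)"
  have "?E * (4 - lam * mu) = (4 - lam * mu) + (v * (4 - lam * mu)) * (1 - lam) +
      (1 - \<alpha>) * ((v * (4 - lam * mu)) * (1 + lam)) + \<beta> * ((4 - lam * mu) - v * (4 - lam * mu))"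
    by (simp add: algebra_simps)
  also have "\<dots> = 2 * (1 - \<alpha>) * (lam * mu + lam + mu) + (lam - 2) * (lam * mu - 4)"
    unfolding u_v_scaled by (simp add: lam_def algebra_simps)
  finally have "?E * (4 - lam * mu) = 2 * (1 - \<alpha>) * (lam * mu + lam + mu) + (lam - 2) * (lam * mu - 4)" .
  moreover have "?E / (2 * (1 + u + v)) = ?E / (1 + u + v) / 2" by simp
  ultimately show ?thesis
    unfolding density_first[OF assms] by (simp only: divide_norm) simp
qed

lemma density_last_value:
  assumes "4 \<le> n" "even n"
  shows "density n (vecf n (weight_even n)) n =
    (2 * (1 - \<gamma>) * (lam * mu + lam + mu) + (mu - 2) * (lam * mu - 4)) / (2 * (lam + mu + 8 - lam * mu))"
proof -
  \<comment> \<open>Twice the numerator of \<open>density_last\<close> with \<open>r0\<close>,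
    \<open>r1\<close> and \<open>rr\<close> eliminated: they occur only in products with
    \<open>v\<close> or \<open>1 - v\<close>, which are linear in \<open>u\<close> and
    \<open>v\<close>.\<close>
  let ?E = "2 - 2 * \<gamma> * v - (1 - \<gamma> - \<delta>) * (1 - u) + u"
  have r: "v * r0 = (1 - u) / 2" "(1 - v) * (1 - r1) = (1 - v) - (1 - u) / 2"
    using r0_r1_eq(1,4) by (simp_all add: right_diff_distrib)
  have "v * rr = v - \<gamma> * v + (\<gamma> - (1 - \<delta>)) * (v * r0)"
    by (simp add: rr_def algebra_simps)
  then have e: "(1 - v) * (1 - r1) + v * r0 + v * rr + u / 2 = ?E / 2"
    unfolding r by (simp add: field_simps)
  have d: "density n (vecf n (weight_even n)) n = ?E / (1 + u + v) / 2"
    unfolding density_last[OF assms] e by simp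
  have "?E * (4 - lam * mu) = 2 * (4 - lam * mu) - 2 * \<gamma> * (v * (4 - lam * mu)) -
      (1 - \<gamma> - \<delta>) * ((4 - lam * mu) - u * (4 - lam * mu)) + u * (4 - lam * mu)"
    by (simp add: algebra_simps)
  also have "\<dots> = 2 * (1 - \<gamma>) * (lam * mu + lam + mu) + (mu - 2) * (lam * mu - 4)"
    unfolding u_v_scaled by (simp add: mu_def algebra_simps)
  finally have "?E * (4 - lam * mu) = 2 * (1 - \<gamma>) * (lam * mu + lam + mu) + (mu - 2) * (lam * mu - 4)" .
  then show ?thesis
    unfolding d by (simp only: divide_norm) simp
qed

end

theorem mainTheorem3:
  fixes n m :: nat and \<alpha> \<beta> \<gamma> \<delta> lam \<mu> :: real
  assumes "n = 2 * m" and "n \<ge> 4"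
    and "0 < \<alpha>" "\<alpha> < 1" and "0 < \<beta>" "\<beta> < 1"
    and "0 < \<gamma>" "\<gamma> < 1" and "0 < \<delta>" "\<delta> < 1"
    and "lam = \<alpha> - \<beta>" and "\<mu> = \<gamma> - \<delta>"
  shows "(\<exists>!p. steady_state n \<alpha> \<beta> \<gamma> \<delta> p) \<and>
    (\<forall>p. steady_state n \<alpha> \<beta> \<gamma> \<delta> p \<longrightarrow>
      (\<forall>j. 1 < j \<and> j < n \<longrightarrow>
         density n p j = (lam + \<mu> + 4) / (lam + \<mu> + 8 - lam * \<mu>)) \<and>
      density n p 1 =
        (2 * (1 - \<alpha>) * (lam * \<mu> + lam + \<mu>) + (lam - 2) * (lam * \<mu> - 4))
          / (2 * (lam + \<mu> + 8 - lam * \<mu>)) \<and>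
      density n p n =
        (2 * (1 - \<gamma>) * (lam * \<mu> + lam + \<mu>) + (\<mu> - 2) * (lam * \<mu> - 4))
          / (2 * (lam + \<mu> + 8 - lam * \<mu>)) \<and>
      (\<forall>k. 1 \<le> k \<and> k \<le> m - 1 \<longrightarrow>
         J_right n p k = (lam + 2) / (lam + \<mu> + 8 - lam * \<mu>)) \<and>
      (\<forall>k. 1 \<le> k \<and> k \<le> m - 2 \<longrightarrow>
         J_left n p k = (\<mu> + 2) / (lam + \<mu> + 8 - lam * \<mu>)) \<and>
      (n \<ge> 6 \<longrightarrow>
         (\<forall>k k'. 1 \<le> k \<and> k \<le> m - 1 \<and> 1 \<le> k' \<and> k' \<le> m - 2 \<longrightarrow>
            J_right n p k - J_left n p k' = (lam - \<mu>) / (lam + \<mu> + 8 - lam * \<mu>))))"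
proof -
  interpret rule54_chain \<alpha> \<beta> \<gamma> \<delta>
    using assms by unfold_locales
  have m: "2 \<le> m" "even n" using assms(1,2) by auto
  have l: "lam = rule54_chain.lam \<alpha> \<beta>" "\<mu> = mu"
    using assms(11,12) by (simp_all add: lam_def mu_def)
  let ?p = "vecf n (weight_even n)"
  have ss: "steady_state n \<alpha> \<beta> \<gamma> \<delta> ?p"
    by (rule steady_state_weight_even[OF assms(1) m(1)])
  have unique: "p = ?p" if "steady_state n \<alpha> \<beta> \<gamma> \<delta> p" for p
    by (rule steady_state_unique[OF assms(1) m(1) assms(3-10) that ss])
  have JR: "J_right n ?p k = (lam + 2) / (lam + \<mu> + 8 - lam * \<mu>)" if "1 \<le> k" "k \<le> m - 1" for k
    unfolding l right_movers_value[symmetric]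
    by (rule J_right_weight_even) (use that assms(1,2) in auto)
  have JL: "J_left n ?p k = (\<mu> + 2) / (lam + \<mu> + 8 - lam * \<mu>)" if "1 \<le> k" "k \<le> m - 2" for k
    unfolding l left_movers_value[symmetric]
    by (rule J_left_weight_even) (use that assms(1,2) in auto)
  have bulk: "density n ?p j = (lam + \<mu> + 4) / (lam + \<mu> + 8 - lam * \<mu>)" if "1 < j" "j < n" for j
    unfolding l bulk_density_value[symmetric] by (rule density_bulk[OF assms(2) that])
  have first: "density n ?p 1 = (2 * (1 - \<alpha>) * (lam * \<mu> + lam + \<mu>) + (lam - 2) * (lam * \<mu> - 4))
      / (2 * (lam + \<mu> + 8 - lam * \<mu>))"
    unfolding l by (rule density_first_value[OF assms(2)])
  have last: "density n ?p n = (2 * (1 - \<gamma>) * (lam * \<mu> + lam + \<mu>) + (\<mu> - 2) * (lam * \<mu> - 4))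
      / (2 * (lam + \<mu> + 8 - lam * \<mu>))"
    unfolding l by (rule density_last_value[OF assms(2) m(2)])
  have J: "J_right n ?p k - J_left n ?p k' = (lam - \<mu>) / (lam + \<mu> + 8 - lam * \<mu>)"
    if "1 \<le> k \<and> k \<le> m - 1 \<and> 1 \<le> k' \<and> k' \<le> m - 2" for k k'
    using JR[of k] JL[of k'] that by (simp flip: diff_divide_distrib)
  show ?thesis
  proof (intro conjI allI impI)
    show "\<exists>!p. steady_state n \<alpha> \<beta> \<gamma> \<delta> p"
      using ss unique by blast
  qed (use bulk first last JR JL J in \<open>auto dest!: unique\<close>)
qed

end
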